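(* Let $g=\{g_n\}_{n\ge 1}$ be the randomized prediction scheme defined in the context (exponentially weighted empirical Markov experts, with weights reset at powers of two). Then $g$ is universal: for every stationary and ergodic binary-valued process $\{Y_n\}_{n=-\infty}^{\infty}$, with randomizing variables $U_1,U_2,\ldots$ that are i.i.d. uniform on $[0,1]$ and independent of $\{Y_n\}$, $$\lim_{n\to\infty} L_1^n(g,U_1^n) = L^* \quad\text{almost surely},$$ where $L_1^n(g,U_1^n)=\frac1n\sum_{i=1}^n I_{\{g_i(Y_1^{i-1},U_i)\ne Y_i\}}$ and $$L^*=\mathbf{E}\left[\min\left(\mathbf{P}\{Y_0=1\mid Y_{-\infty}^{-1}\},\ \mathbf{P}\{Y_0=0\mid Y_{-\infty}^{-1}\}\right)\right].$$
   Context: Notation: $y_a^b=(y_a,\ldots,y_b)$, $y_1^0$ is the empty string, $Y_{-\infty}^{-1}=(\ldots,Y_{-2},Y_{-1})$, $I$ is the indicator function. A prediction strategy is a sequence $g=\{g_i\}_{i\ge1}$ of functions $g_i:\{0,1\}^{i-1}\times[0,1]\to\{0,1\}$; at time $i$ it predicts $y_i$ by $g_i(y_1^{i-1},U_i)$. Experts. For integers $k\ge1$, $n\ge1$, $s\in\{0,1\}^k$, $y\in\{0,1\}$, and $y_1^{n-1}\in\{0,1\}^{n-1}$ define, for $n>k+1$, $$\widehat P_n^k(y,y_1^{n-1},s)=\frac{|\{k<i<n:\ y_{i-k}^{i-1}=s,\ y_i=y\}|}{|\{k<i<n:\ y_{i-k}^{i-1}=s\}|},$$ with $0/0:=1/2$;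 for $n\le k+1$ set $\widehat P_n^k(y,y_1^{n-1},s)=1/2$. The expert $h^{(k)}$ is the (nonrandomized) strategy $$h_n^{(k)}(y_1^{n-1})=\begin{cases}0 & \text{if } \widehat P_n^k(0,y_1^{n-1},y_{n-k}^{n-1})>\tfrac12,\\ 1&\text{otherwise},\end{cases}\qquad n=1,2,\ldots$$ (when $n\le k+1$ the estimate is $1/2$, so the prediction is $1$). Losses of experts: for $a\le b$, $L_a^b(h^{(k)})=\frac{1}{b-a+1}\sum_{i=a}^b I_{\{h_i^{(k)}(y_1^{i-1})\ne y_i\}}$. The scheme $g$. For each integer $m\ge0$ and each $n$ with $2^m\le n<2^{m+1}$, $$g_n(y_1^{n-1},u)=\begin{cases}0 & \text{if } u>\dfrac{\sum_{k=1}^{2^{m+1}}h_n^{(k)}(y_1^{n-1})\,w_n(k)}{\sum_{k=1}^{2^{m+1}}w_n(k)},\\ 1&\text{otherwise},\end{cases}$$ where $w_{2^m}(k)=1$ and $w_n(k)=e^{-\eta_m (n-2^m)L_{2^m}^{n-1}(h^{(k)})}$ for $2^m<n<2^{m+1}$, with $\eta_m=\sqrt{8\ln(2^{m+1})/2^m}$. *)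

theory Defs
  imports "HOL-Probability.Probability" "HOL-Library.Discrete_Functions"
begin

(* The alphabet {0,1} is bool (0 = False, 1 = True), and of_bool is the numerical value.
   A string y_1^l is the list [y_1, ..., y_l], so y_j is entry j - 1 of the list.  At time n
   strategies and experts receive a string of length n - 1; the random variable U ranges over
   real rather than the interval [0,1]. *)

type_synonym strategy = "nat \<Rightarrow> bool list \<Rightarrow> real \<Rightarrow> bool"
type_synonym expert = "nat \<Rightarrow> bool list \<Rightarrow> bool"

text \<open>\<open>substr ys a b\<close> is the string \<open>y_a^b\<close>; it is empty if \<open>b < a\<close>.\<close>

definition substr :: "bool list \<Rightarrow> nat \<Rightarrow> nat \<Rightarrow> bool list" where
  "substr ys a b = map (\<lambda>j. ys ! (j - 1)) [a..<b + 1]"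

definition markov_est :: "nat \<Rightarrow> nat \<Rightarrow> bool \<Rightarrow> bool list \<Rightarrow> bool list \<Rightarrow> real" where
  "markov_est k n y ys s =
     (let num = card {i. k < i \<and> i < n \<and> substr ys (i - k) (i - 1) = s \<and> ys ! (i - 1) = y};
          den = card {i. k < i \<and> i < n \<and> substr ys (i - k) (i - 1) = s}
      in if n \<le> k + 1 \<or> den = 0 then 1 / 2 else real num / real den)"

(* For n <= k the context substr ys (n - k) (n - 1) is meaningless (n - k is truncated),
   but markov_est ignores it then. *)

definition markov_expert :: "nat \<Rightarrow> expert" where
  "markov_expert k n ys =
     (if markov_est k n False ys (substr ys (n - k) (n - 1)) > 1 / 2 then False else True)"

definition expert_loss :: "expert \<Rightarrow> nat \<Rightarrow> nat \<Rightarrow> bool list \<Rightarrow> real" where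
  "expert_loss h a b ys =
     (\<Sum>i = a..b. of_bool (h i (substr ys 1 (i - 1)) \<noteq> ys ! (i - 1))) / (real b - real a + 1)"

definition eta :: "nat \<Rightarrow> real" where
  "eta m = sqrt (8 * ln (2 ^ (m + 1)) / 2 ^ m)"

lemma floor_log_block: "n \<ge> 1 \<Longrightarrow> floor_log n = m \<longleftrightarrow> 2 ^ m \<le> n \<and> n < 2 ^ (m + 1)"
  using floor_log_exp2_le[of n] floor_log_exp2_gt[of n] floor_log_eqI[of n m] by auto

definition weight :: "nat \<Rightarrow> nat \<Rightarrow> bool list \<Rightarrow> real" where
  "weight n k ys =
     (let m = floor_log n
      in if n = 2 ^ m then 1
         else exp (- eta m * (real n - 2 ^ m) * expert_loss (markov_expert k) (2 ^ m) (n - 1) ys))"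

definition scheme :: strategy where
  "scheme n ys u =
     (let K = 2 ^ (floor_log n + 1)
      in if u > (\<Sum>k = 1..K. of_bool (markov_expert k n ys) * weight n k ys) / (\<Sum>k = 1..K. weight n k ys)
         then False else True)"

text \<open>\<open>L_1^n(g, u_1^n)\<close> along a realisation \<open>y\<close> of the two-sided process.\<close>

definition strategy_loss :: "strategy \<Rightarrow> nat \<Rightarrow> (int \<Rightarrow> bool) \<Rightarrow> (nat \<Rightarrow> real) \<Rightarrow> real" where
  "strategy_loss g n y u =
     (\<Sum>i = 1..n. of_bool (g i (map y [1..int i - 1]) (u i) \<noteq> y (int i))) / real n"

abbreviation path_space :: "(int \<Rightarrow> bool) measure" where
  "path_space \<equiv> Pi\<^sub>M UNIV (\<lambda>_. count_space UNIV)"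

definition binary_process :: "'a measure \<Rightarrow> (int \<Rightarrow> 'a \<Rightarrow> bool) \<Rightarrow> bool" where
  "binary_process M Y \<longleftrightarrow> (\<forall>n. Y n \<in> M \<rightarrow>\<^sub>M count_space UNIV)"

definition stationary :: "'a measure \<Rightarrow> (int \<Rightarrow> 'a \<Rightarrow> bool) \<Rightarrow> bool" where
  "stationary M Y \<longleftrightarrow>
     distr M path_space (\<lambda>\<omega> n. Y (n + 1) \<omega>) = distr M path_space (\<lambda>\<omega> n. Y n \<omega>)"

definition ergodic :: "'a measure \<Rightarrow> (int \<Rightarrow> 'a \<Rightarrow> bool) \<Rightarrow> bool" where
  "ergodic M Y \<longleftrightarrow>
     (\<forall>A \<in> sets path_space. (\<lambda>y n. y (n + 1)) -` A = A \<longrightarrow>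
        measure M {\<omega> \<in> space M. (\<lambda>n. Y n \<omega>) \<in> A} \<in> {0, 1})"

definition past_algebra :: "'a measure \<Rightarrow> (int \<Rightarrow> 'a \<Rightarrow> bool) \<Rightarrow> 'a measure" where
  "past_algebra M Y =
     vimage_algebra (space M) (\<lambda>\<omega>. \<lambda>n\<in>{..<0}. Y n \<omega>) (Pi\<^sub>M {..<0} (\<lambda>_. count_space UNIV))"

definition cond_prob_past :: "'a measure \<Rightarrow> (int \<Rightarrow> 'a \<Rightarrow> bool) \<Rightarrow> bool \<Rightarrow> 'a \<Rightarrow> real" where
  "cond_prob_past M Y b =
     real_cond_exp M (past_algebra M Y) (indicat_real {\<omega> \<in> space M. Y 0 \<omega> = b})"

definition optimal_loss :: "'a measure \<Rightarrow> (int \<Rightarrow> 'a \<Rightarrow> bool) \<Rightarrow> real" where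
  "optimal_loss M Y =
     integral\<^sup>L M (\<lambda>\<omega>. min (cond_prob_past M Y True \<omega>) (cond_prob_past M Y False \<omega>))"

definition iid_uniform :: "'a measure \<Rightarrow> (nat \<Rightarrow> 'a \<Rightarrow> real) \<Rightarrow> bool" where
  "iid_uniform M U \<longleftrightarrow>
     prob_space.indep_vars M (\<lambda>_. borel) U {1..} \<and>
     (\<forall>i\<ge>1. distr M borel (U i) = uniform_measure lborel {0..1})"

(* indep_var needs both variables to have the same value type, hence independence is stated
   for the generated sigma-algebras. *)

definition indep_processes :: "'a measure \<Rightarrow> (nat \<Rightarrow> 'a \<Rightarrow> real) \<Rightarrow> (int \<Rightarrow> 'a \<Rightarrow> bool) \<Rightarrow> bool" where
  "indep_processes M U Y \<longleftrightarrow>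
     prob_space.indep_set M
       (sets (vimage_algebra (space M) (\<lambda>\<omega>. \<lambda>i\<in>{1..}. U i \<omega>) (Pi\<^sub>M {1..} (\<lambda>_. borel))))
       (sets (vimage_algebra (space M) (\<lambda>\<omega> n. Y n \<omega>) path_space))"

end

theory Submission
  imports Defs
begin

text \<open>
  Along a fixed path \<open>y\<close> the scheme errs at time \<open>i\<close> with probability \<open>\<bar>p - y\<^sub>i\<bar>\<close>, where \<open>p\<close> is
  the weighted vote of the experts (\<open>mean_pred\<close>); this number is \<open>mean_err y i\<close>.  The proof
  compares three averages.

  The realised loss against the average of \<open>mean_err\<close>: the differences are bounded and pairwise
  orthogonal, because the randomizing variables are independent of each other and of the path.
  The strong law for orthogonal sequences makes their averages vanish
  (\<open>randomization_averages_out\<close>).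

  The average of \<open>mean_err\<close> from below: let \<open>t\<close> be the conditional probability that the next symbol
  is 1 given the infinite past (\<open>true_prob\<close>).  For every prediction \<open>p\<close> made from the past,
  \<open>\<bar>p - y\<^sub>i\<bar>\<close> exceeds its conditional mean \<open>p * (1 - t) + (1 - p) * t\<close> by \<open>(1 - 2 * p) * (y\<^sub>i - t)\<close>,
  and these differences are again orthogonal (\<open>err_minus_cond_err_vanishes\<close>).  The conditional mean
  is at least \<open>min t (1 - t)\<close>, whose time averages tend to the optimal loss by Birkhoff's theorem
  (\<open>liminf_mean_err\<close>).

  The average of \<open>mean_err\<close> from above: exponential weighting costs only \<open>o(n)\<close> more errors than any
  fixed expert (\<open>scheme_tracks_expert\<close>), so it suffices to find an expert whose error rate is close to
  optimal (\<open>limsup_expert_err\<close>).  For order \<open>k\<close> let \<open>markov_loss k\<close> be the error of the best prediction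
  from the last \<open>k\<close> symbols.  By Birkhoff's theorem the empirical majority in a context eventually
  agrees with the true majority, unless the two continuations of the context are equally likely.
  Such ties cannot be ignored: in the process of period four \<open>0011\<close>, for some starting phases, the
  expert of order 1 is wrong every time the last symbol is 0.  So in tied contexts the expert is
  granted nothing, and its conditional error is bounded by \<open>max t (1 - t)\<close> there.  In such a
  context the best prediction from the last \<open>k\<close> symbols errs half of the time, so the mean of
  \<open>max t (1 - t)\<close> exceeds one half by exactly as much as the mean of \<open>min t (1 - t)\<close> stays below it.
  Hence the error rate of the expert is at most \<open>markov_loss k\<close> plus the excess of \<open>markov_loss k\<close>
  over the optimal loss (\<open>integral_plugin_bound_le\<close>).  That excess becomes small because the event
  \<open>t > 1 / 2\<close> is approximated by events that depend on finitely many past symbols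
  (\<open>markov_loss_close\<close>).
\<close>

section \<open>Averages of orthogonal sequences\<close>

text \<open>
  Between \<open>m^2\<close> and \<open>(m + 1)^2\<close> a sum with terms of size at most 1 moves by at most \<open>2 * m\<close>, which is
  negligible against \<open>m^2\<close>.
\<close>

lemma average_tendsto_0_along_squares:
  fixes x :: "nat \<Rightarrow> real"
  assumes bnd: "\<And>i. \<bar>x i\<bar> \<le> 1"
    and sq: "(\<lambda>m. (\<Sum>i=1..m^2. x i) / real (m^2)) \<longlonglongrightarrow> 0"
  shows "(\<lambda>n. (\<Sum>i=1..n. x i) / real n) \<longlonglongrightarrow> 0"
proof -
  define S where "S n = (\<Sum>i=1..n. x i)" for n
  have step: "\<bar>S n / n\<bar> \<le> \<bar>S ((floor_sqrt n)^2) / real ((floor_sqrt n)^2)\<bar> + 2 / real (floor_sqrt n)"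
    if n: "n \<ge> 1" for n
  proof -
    define m where "m = floor_sqrt n"
    have m1: "m \<ge> 1" using n unfolding m_def by (simp add: Suc_leI)
    have le: "m^2 \<le> n" unfolding m_def by simp
    have lt: "n < (m+1)^2" unfolding m_def using Suc_floor_sqrt_power2_gt[of n] by simp
    have "S n = S (m^2) + (\<Sum>i=m^2+1..n. x i)"
      unfolding S_def using sum.ub_add_nat[of 1 "m^2" x "n - m^2"] le by simp
    moreover have "\<bar>\<Sum>i=m^2+1..n. x i\<bar> \<le> (\<Sum>i=m^2+1..n. 1)"
      by (rule order_trans[OF sum_abs]) (intro sum_mono bnd)
    moreover have "(\<Sum>i=m^2+1..n. 1) = real n - real (m^2)" using le by (simp add: of_nat_diff)
    moreover have "real n - real (m^2) \<le> 2 * m"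
    proof -
      have "n \<le> m^2 + 2 * m" using lt by (simp add: power2_eq_square)
      then have "real n \<le> real (m^2 + 2 * m)" by (rule of_nat_mono)
      then show ?thesis by simp
    qed
    ultimately have b: "\<bar>S n\<bar> \<le> \<bar>S (m^2)\<bar> + 2 * m" by linarith
    have "\<bar>S n / n\<bar> = \<bar>S n\<bar> / n" by simp
    also have "\<dots> \<le> (\<bar>S (m^2)\<bar> + 2 * m) / n" using b by (simp add: divide_right_mono)
    also have "\<dots> \<le> (\<bar>S (m^2)\<bar> + 2 * m) / real (m^2)"
      using n m1 of_nat_mono[OF le, where 'a=real] by (intro divide_left_mono) auto
    also have "\<dots> = \<bar>S (m^2) / real (m^2)\<bar> + 2 / m"
      using m1 by (simp add: add_divide_distrib power2_eq_square)
    finally show ?thesis unfolding m_def .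
  qed
  have fs: "filterlim floor_sqrt sequentially sequentially"
  proof (rule filterlim_at_top[THEN iffD2], rule allI)
    fix Z :: nat
    show "\<forall>\<^sub>F n in sequentially. Z \<le> floor_sqrt n"
      using eventually_ge_at_top[of "Z^2"]
      by eventually_elim (simp add: le_floor_sqrt_iff)
  qed
  have l1: "(\<lambda>n. \<bar>S ((floor_sqrt n)^2) / real ((floor_sqrt n)^2)\<bar>) \<longlonglongrightarrow> 0"
    using filterlim_compose[OF sq[folded S_def] fs] by (rule tendsto_rabs_zero)
  have l2: "(\<lambda>n. 2 / real (floor_sqrt n)) \<longlonglongrightarrow> 0"
    by (rule filterlim_compose[OF _ fs, where g = "\<lambda>m. 2 / real m"]) real_asymp
  show ?thesis unfolding S_def[symmetric]
  proof (rule Lim_null_comparison)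
    show "\<forall>\<^sub>F n in sequentially. norm (S n / n) \<le>
      \<bar>S ((floor_sqrt n)^2) / real ((floor_sqrt n)^2)\<bar> + 2 / real (floor_sqrt n)"
      using eventually_ge_at_top[of 1] by eventually_elim (use step in simp)
    show "(\<lambda>n. \<bar>S ((floor_sqrt n)^2) / real ((floor_sqrt n)^2)\<bar> + 2 / real (floor_sqrt n)) \<longlonglongrightarrow> 0"
      using tendsto_add[OF l1 l2] by simp
  qed
qed

text \<open>
  Orthogonality gives the sum of \<open>n\<close> terms a second moment of at most \<open>n\<close>, so along the squares
  \<open>n = m^2\<close> the expected squared averages are at most \<open>1 / m^2\<close> and hence summable.
\<close>

lemma (in prob_space) slln_orthogonal:
  fixes X :: "nat \<Rightarrow> 'a \<Rightarrow> real"
  assumes meas[measurable]: "\<And>i. X i \<in> borel_measurable M"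
    and bnd: "\<And>i x. \<bar>X i x\<bar> \<le> 1"
    and orth: "\<And>i j. 1 \<le> i \<Longrightarrow> i < j \<Longrightarrow> expectation (\<lambda>x. X i x * X j x) = 0"
  shows "AE x in M. (\<lambda>n. (\<Sum>i=1..n. X i x) / real n) \<longlonglongrightarrow> 0"
proof -
  have int: "integrable M (\<lambda>x. X i x * X j x)" for i j
    by (rule integrable_const_bound[where B=1]) (auto simp: abs_mult bnd intro!: mult_le_one)
  have second_moment: "expectation (\<lambda>x. (\<Sum>i=1..n. X i x)^2) \<le> real n" for n
  proof -
    have "expectation (\<lambda>x. (\<Sum>i=1..n. X i x)^2)
        = (\<Sum>i=1..n. \<Sum>j=1..n. expectation (\<lambda>x. X i x * X j x))"
      using int by (simp add: power2_eq_square sum_product integral_sum)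
    also have "\<dots> \<le> (\<Sum>i=1..n. \<Sum>j=1..n. if i = j then 1 else 0)"
    proof (intro sum_mono)
      fix i j assume ij: "i \<in> {1..n}" "j \<in> {1..n}"
      have "expectation (\<lambda>x. X i x * X i x) \<le> expectation (\<lambda>_. 1)"
        by (intro integral_mono int) (use abs_square_le_1[of "X i _"] bnd in \<open>auto simp: power2_eq_square\<close>)
      then show "expectation (\<lambda>x. X i x * X j x) \<le> (if i = j then 1 else 0)"
        using orth[of i j] orth[of j i] ij
        by (cases i j rule: linorder_cases) (auto simp: prob_space mult.commute)
    qed
    finally show ?thesis by simp
  qed
  define Z where "Z m x = ((\<Sum>i=1..(Suc m)^2. X i x) / real ((Suc m)^2))^2" for m x
  have [measurable]: "Z m \<in> borel_measurable M" for m unfolding Z_def by measurable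
  have Zint: "integrable M (Z m)" for m
  proof (rule integrable_const_bound[where B=1])
    show "AE x in M. norm (Z m x) \<le> 1"
    proof (rule AE_I2)
      fix x
      have "\<bar>\<Sum>i=1..(Suc m)^2. X i x\<bar> \<le> (\<Sum>i=1..(Suc m)^2. 1)"
        by (rule order_trans[OF sum_abs]) (intro sum_mono bnd)
      then have "\<bar>(\<Sum>i=1..(Suc m)^2. X i x) / real ((Suc m)^2)\<bar> \<le> 1"
        by (simp only: sum_constant abs_divide) (simp add: divide_le_eq)
      then show "norm (Z m x) \<le> 1" unfolding Z_def by (simp add: abs_square_le_1)
    qed
  qed simp
  have Zexp: "expectation (Z m) \<le> 1 / (real (Suc m))^2" for m
  proof -
    have "expectation (Z m) = expectation (\<lambda>x. (\<Sum>i=1..(Suc m)^2. X i x)^2) / (real ((Suc m)^2))^2"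
      unfolding Z_def power_divide by simp
    also have "\<dots> \<le> real ((Suc m)^2) / (real ((Suc m)^2))^2"
      by (intro divide_right_mono second_moment) simp
    also have "\<dots> = 1 / (real (Suc m))^2"
      by (simp only: of_nat_power) (simp add: power2_eq_square del: of_nat_Suc)
    finally show ?thesis .
  qed
  have "(\<integral>\<^sup>+x. (\<Sum>m. ennreal (Z m x)) \<partial>M) = (\<Sum>m. \<integral>\<^sup>+x. ennreal (Z m x) \<partial>M)"
    by (rule nn_integral_suminf) simp
  also have "\<dots> = (\<Sum>m. ennreal (expectation (Z m)))"
    by (intro suminf_cong nn_integral_eq_integral Zint) (simp add: Z_def)
  also have "\<dots> \<le> (\<Sum>m. ennreal (1 / (real (Suc m))^2))"
    by (intro suminf_le ennreal_leI Zexp) auto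
  also have "\<dots> < \<infinity>"
  proof -
    have "summable (\<lambda>m. 1 / (real (Suc m))^2)"
      using inverse_power_summable[of 2, where 'a=real]
      by (subst summable_Suc_iff) (simp add: field_simps)
    then show ?thesis by (subst suminf_ennreal2) auto
  qed
  finally have "AE x in M. (\<Sum>m. ennreal (Z m x)) \<noteq> \<infinity>"
    by (intro nn_integral_PInf_AE) auto
  then show ?thesis
  proof eventually_elim
    case (elim x)
    have "summable (\<lambda>m. Z m x)"
      by (rule summable_suminf_not_top) (use elim in \<open>auto simp: Z_def\<close>)
    then have "(\<lambda>m. Z m x) \<longlonglongrightarrow> 0" by (rule summable_LIMSEQ_zero)
    then have "(\<lambda>m. sqrt (Z m x)) \<longlonglongrightarrow> 0" using tendsto_real_sqrt[of "\<lambda>m. Z m x" 0] by simp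
    then have "(\<lambda>m. \<bar>(\<Sum>i=1..(Suc m)^2. X i x) / real ((Suc m)^2)\<bar>) \<longlonglongrightarrow> 0"
      unfolding Z_def by (simp only: real_sqrt_abs)
    then have "(\<lambda>m. (\<Sum>i=1..(Suc m)^2. X i x) / real ((Suc m)^2)) \<longlonglongrightarrow> 0"
      by (rule tendsto_rabs_zero_cancel)
    then have "(\<lambda>m. (\<Sum>i=1..m^2. X i x) / real (m^2)) \<longlonglongrightarrow> 0"
      by (rule LIMSEQ_imp_Suc)
    then show ?case by (intro average_tendsto_0_along_squares bnd)
  qed
qed

section \<open>Birkhoff's theorem for bounded functions\<close>

definition birkhoff_sum :: "('a \<Rightarrow> 'a) \<Rightarrow> ('a \<Rightarrow> real) \<Rightarrow> nat \<Rightarrow> 'a \<Rightarrow> real" where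
  "birkhoff_sum T f n x = (\<Sum>i<n. f ((T ^^ i) x))"

lemma birkhoff_sum_Suc: "birkhoff_sum T f (Suc n) x = f x + birkhoff_sum T f n (T x)"
  unfolding birkhoff_sum_def sum.lessThan_Suc_shift by (simp add: funpow_swap1)

text \<open>
  The maximum of 0 and the Birkhoff sums of length at most \<open>n\<close>, in the recursive form that Garsia's
  proof of the maximal inequality works with.
\<close>

primrec max_birkhoff :: "('a \<Rightarrow> 'a) \<Rightarrow> ('a \<Rightarrow> real) \<Rightarrow> nat \<Rightarrow> 'a \<Rightarrow> real" where
  "max_birkhoff T f 0 x = 0"
| "max_birkhoff T f (Suc n) x = max 0 (f x + max_birkhoff T f n (T x))"

lemma max_birkhoff_nonneg: "max_birkhoff T f n x \<ge> 0"
  by (cases n) auto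

lemma max_birkhoff_mono: "max_birkhoff T f n x \<le> max_birkhoff T f (Suc n) x"
proof (induction n arbitrary: x)
  case (Suc n)
  show ?case using Suc[of "T x"] by simp
qed simp

lemma max_birkhoff_ge: "j \<le> n \<Longrightarrow> birkhoff_sum T f j x \<le> max_birkhoff T f n x"
proof (induction n arbitrary: j x)
  case 0
  then show ?case by (simp add: birkhoff_sum_def)
next
  case (Suc n)
  show ?case
  proof (cases j)
    case 0
    then show ?thesis by (simp add: birkhoff_sum_def)
  next
    case j: (Suc i)
    have "birkhoff_sum T f i (T x) \<le> max_birkhoff T f n (T x)"
      using Suc.IH[of i "T x"] Suc.prems j by simp
    then show ?thesis unfolding j birkhoff_sum_Suc by simp
  qed
qed

locale measure_preserving_map = prob_space +
  fixes T :: "'a \<Rightarrow> 'a"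
  assumes T_measurable[measurable]: "T \<in> M \<rightarrow>\<^sub>M M"
    and distr_T: "distr M M T = M"
begin

lemma funpow_T_measurable[measurable]: "(T ^^ i) \<in> M \<rightarrow>\<^sub>M M"
  by (rule measurable_compose_n) simp

lemma distr_funpow_T: "distr M M (T ^^ i) = M"
proof (induction i)
  case (Suc i)
  have "distr M M (T ^^ Suc i) = distr (distr M M (T ^^ i)) M T"
    by (subst distr_distr) (auto simp: comp_def)
  also have "\<dots> = M" unfolding Suc distr_T ..
  finally show ?case .
qed (simp add: distr_id2)

lemma integral_funpow_T:
  fixes f :: "'a \<Rightarrow> real"
  assumes [measurable]: "f \<in> borel_measurable M"
  shows "(\<integral>x. f ((T ^^ i) x) \<partial>M) = (\<integral>x. f x \<partial>M)"
  by (subst (2) distr_funpow_T[of i, symmetric]) (simp add: integral_distr)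

text \<open>
  Let \<open>m\<close> be \<open>max_birkhoff T f (Suc n)\<close>.  Where \<open>m\<close> is positive, the recursion and monotonicity in \<open>n\<close>
  give \<open>f \<ge> m - m \<circ> T\<close>; elsewhere \<open>m - m \<circ> T \<le> 0\<close>.  Since \<open>T\<close> preserves the measure, \<open>m - m \<circ> T\<close>
  has integral 0, so \<open>f\<close> has nonnegative integral over the set where \<open>m\<close> is positive.  These sets
  exhaust almost all of the space as \<open>n\<close> grows.
\<close>

lemma maximal_ergodic:
  assumes f[measurable]: "f \<in> borel_measurable M" and bnd: "\<And>x. \<bar>f x\<bar> \<le> C"
    and pos: "AE x in M. \<exists>n. birkhoff_sum T f n x > 0"
  shows "(\<integral>x. f x \<partial>M) \<ge> 0"
proof -
  let ?m = "max_birkhoff T f"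
  have [measurable]: "?m n \<in> borel_measurable M" for n by (induction n) simp_all
  have C0: "C \<ge> 0" using bnd[of undefined] by linarith
  have mb: "\<bar>?m n x\<bar> \<le> n * C" for n x
  proof (induction n arbitrary: x)
    case (Suc n)
    have "f x \<le> C" using bnd[of x] by linarith
    moreover have "?m n (T x) \<le> n * C" using Suc[of "T x"] by linarith
    moreover have "real (Suc n) * C \<ge> 0" using C0 by simp
    ultimately show ?case by (simp add: algebra_simps)
  qed simp
  have mi: "integrable M (?m n)" for n
    by (rule integrable_const_bound[where B="n*C"]) (auto simp: mb)
  have miT: "integrable M (\<lambda>x. ?m n (T x))" for n
    by (rule integrable_const_bound[where B="n*C"]) (auto simp: mb)
  have fin: "0 \<le> (\<integral>x. indicator {x. ?m (Suc n) x > 0} x * f x \<partial>M)" for n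
  proof -
    have "(\<integral>x. ?m (Suc n) (T x) \<partial>M) = (\<integral>x. ?m (Suc n) x \<partial>M)"
      using integral_funpow_T[of "?m (Suc n)" 1] by simp
    then have "0 = (\<integral>x. ?m (Suc n) x - ?m (Suc n) (T x) \<partial>M)"
      using mi[of "Suc n"] miT[of "Suc n"] by (simp del: max_birkhoff.simps)
    also have "\<dots> \<le> (\<integral>x. indicator {x. ?m (Suc n) x > 0} x * f x \<partial>M)"
    proof (rule integral_mono)
      show "integrable M (\<lambda>x. indicator {x. ?m (Suc n) x > 0} x * f x)"
        by (rule integrable_const_bound[where B=C])
           (auto simp: indicator_def bnd C0 simp del: max_birkhoff.simps)
      show "?m (Suc n) x - ?m (Suc n) (T x) \<le> indicator {x. ?m (Suc n) x > 0} x * f x" for x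
        using max_birkhoff_mono[of T f n "T x"] max_birkhoff_nonneg[of T f "Suc n" "T x"]
        by (auto simp: indicator_def simp del: max_birkhoff.simps)
           (auto split: if_splits simp: max_def)
    qed (intro Bochner_Integration.integrable_diff mi miT)
    finally show ?thesis .
  qed
  have "(\<lambda>n. \<integral>x. indicator {x. ?m (Suc n) x > 0} x * f x \<partial>M) \<longlonglongrightarrow> (\<integral>x. f x \<partial>M)"
  proof (rule integral_dominated_convergence[where w="\<lambda>_. C"])
    show "AE x in M. (\<lambda>n. indicator {x. ?m (Suc n) x > 0} x * f x) \<longlonglongrightarrow> f x"
      using pos
    proof eventually_elim
      case (elim x)
      then obtain j where j: "birkhoff_sum T f j x > 0" by blast
      have "\<forall>\<^sub>F n in sequentially. indicator {x. ?m (Suc n) x > 0} x * f x = f x"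
        using eventually_ge_at_top[of j]
      proof eventually_elim
        case (elim n)
        have "?m (Suc n) x > 0" using j max_birkhoff_ge[of j "Suc n" T f x] elim by linarith
        then show ?case by (simp del: max_birkhoff.simps)
      qed
      then show ?case by (rule tendsto_eventually)
    qed
  qed (auto simp: indicator_def bnd C0 simp del: max_birkhoff.simps)
  then show ?thesis
    by (rule LIMSEQ_le_const) (use fin in blast)
qed

end

locale ergodic_map = measure_preserving_map +
  assumes invariant_trivial:
    "\<And>A. A \<in> sets M \<Longrightarrow> T -` A \<inter> space M = A \<Longrightarrow> prob A = 0 \<or> prob A = 1"
begin

text \<open>
  The limit superior of the averages is invariant under \<open>T\<close>, so the set where it exceeds \<open>a\<close> has
  probability 0 or 1.  Probability 1 would produce, almost everywhere, a positive Birkhoff sum of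
  \<open>f - a\<close>, and then the maximal inequality would force the mean of \<open>f\<close> to be at least \<open>a\<close>.
\<close>

lemma birkhoff_limsup_le:
  assumes f[measurable]: "f \<in> borel_measurable M" and bnd: "\<And>x. \<bar>f x\<bar> \<le> C"
    and a: "(\<integral>x. f x \<partial>M) < a"
  shows "AE x in M. limsup (\<lambda>n. ereal (birkhoff_sum T f n x / n)) \<le> a"
proof -
  let ?L = "\<lambda>x. limsup (\<lambda>n. ereal (birkhoff_sum T f n x / n))"
  have [measurable]: "(\<lambda>x. birkhoff_sum T f n x) \<in> borel_measurable M" for n
    unfolding birkhoff_sum_def by measurable
  have C0: "C \<ge> 0" using bnd[of undefined] by linarith
  have inv: "?L (T x) = ?L x" for x
  proof -
    define d where "d n = (f ((T ^^ n) x) - f x) / n" for n :: nat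
    have "birkhoff_sum T f n (T x) = birkhoff_sum T f n x + f ((T ^^ n) x) - f x" for n
      using birkhoff_sum_Suc[of T f n x] by (simp add: birkhoff_sum_def)
    then have eq: "ereal (birkhoff_sum T f n (T x) / n)
        = ereal (d n) + ereal (birkhoff_sum T f n x / n)" for n
      by (simp add: d_def diff_divide_distrib add_divide_distrib)
    have "d \<longlonglongrightarrow> 0"
    proof (rule Lim_null_comparison)
      have "\<bar>f ((T ^^ n) x) - f x\<bar> \<le> 2 * C" for n
        using bnd[of "(T ^^ n) x"] bnd[of x] by linarith
      then show "\<forall>\<^sub>F n in sequentially. norm (d n) \<le> 2 * C / n"
        unfolding d_def by (intro always_eventually allI) (simp add: divide_right_mono)
      show "(\<lambda>n. 2 * C / real n) \<longlonglongrightarrow> 0" by real_asymp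
    qed
    then have "(\<lambda>n. ereal (d n)) \<longlonglongrightarrow> 0" using tendsto_ereal zero_ereal_def by metis
    from ereal_limsup_lim_add[OF this] show ?thesis unfolding eq by (simp del: plus_ereal.simps)
  qed
  define A where "A = {x \<in> space M. ?L x > a}"
  have A: "A \<in> sets M" unfolding A_def by measurable
  have "T -` A \<inter> space M = A"
    using measurable_space[OF T_measurable] unfolding A_def by (auto simp: inv)
  then consider "prob A = 0" | "prob A = 1" using invariant_trivial[OF A] by blast
  then show ?thesis
  proof cases
    case 1
    then have "AE x in M. x \<notin> A" using A by (simp add: AE_iff_measurable emeasure_eq_measure prob_eq_0)
    then show ?thesis by (rule AE_mp) (auto intro!: AE_I2 simp: A_def not_less)
  next
    case 2
    then have "AE x in M. x \<in> A" using A by (simp add: prob_eq_1)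
    then have "AE x in M. \<exists>n. birkhoff_sum T (\<lambda>x. f x - a) n x > 0"
    proof eventually_elim
      case (elim x)
      have "\<exists>n\<ge>1. birkhoff_sum T f n x / n > a"
      proof (rule ccontr)
        assume "\<not> ?thesis"
        then have "\<forall>\<^sub>F n in sequentially. ereal (birkhoff_sum T f n x / n) \<le> a"
          by (intro eventually_sequentiallyI[of 1]) (auto simp: not_less)
        then have "?L x \<le> a" by (rule Limsup_bounded)
        moreover have "?L x > a" using elim by (simp add: A_def)
        ultimately show False using leD by blast
      qed
      then obtain n where n: "n \<ge> 1" "birkhoff_sum T f n x / n > a" by blast
      then have "birkhoff_sum T f n x > n * a" by (simp add: field_simps)
      then have "birkhoff_sum T (\<lambda>x. f x - a) n x > 0"
        by (simp add: birkhoff_sum_def sum_subtractf)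
      then show ?case ..
    qed
    then have "(\<integral>x. f x - a \<partial>M) \<ge> 0"
      by (rule maximal_ergodic[where C = "C + \<bar>a\<bar>", rotated 2])
         (use bnd in \<open>auto intro!: order_trans[OF abs_triangle_ineq4] add_mono\<close>)
    moreover have "integrable M f" by (rule integrable_const_bound[where B=C]) (auto simp: bnd)
    ultimately show ?thesis using a by (simp add: prob_space)
  qed
qed

theorem birkhoff:
  assumes f[measurable]: "f \<in> borel_measurable M" and bnd: "\<And>x. \<bar>f x\<bar> \<le> C"
  shows "AE x in M. (\<lambda>n. birkhoff_sum T f n x / n) \<longlonglongrightarrow> (\<integral>x. f x \<partial>M)"
proof -
  let ?E = "\<integral>x. f x \<partial>M"
  have "AE x in M. \<forall>k. limsup (\<lambda>n. ereal (birkhoff_sum T f n x / n)) \<le> ?E + 1 / Suc k"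
    unfolding AE_all_countable by (intro allI birkhoff_limsup_le[where C=C])
       (simp_all add: bnd del: of_nat_Suc)
  moreover have "AE x in M. \<forall>k. limsup (\<lambda>n. ereal (birkhoff_sum T (\<lambda>x. - f x) n x / n)) \<le> - ?E + 1 / Suc k"
    unfolding AE_all_countable
    by (intro allI birkhoff_limsup_le[where C=C]) (simp_all add: bnd del: of_nat_Suc)
  ultimately show ?thesis
  proof eventually_elim
    case (elim x)
    have up: "\<forall>\<^sub>F n in sequentially. birkhoff_sum T g n x / n < E + e"
      if "\<forall>k. limsup (\<lambda>n. ereal (birkhoff_sum T g n x / n)) \<le> E + 1 / Suc k" "e > 0" for g E and e :: real
    proof -
      obtain k where "1 / Suc k < e" using nat_approx_posE[OF \<open>e > 0\<close>] by metis
      then have "ereal (E + 1 / Suc k) < ereal (E + e)" by simp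
      then have "limsup (\<lambda>n. ereal (birkhoff_sum T g n x / n)) < ereal (E + e)"
        using that(1) order.strict_trans1 by blast
      from Limsup_lessD[OF this] show ?thesis by simp
    qed
    show ?case
    proof (rule tendstoI)
      fix e :: real assume e: "e > 0"
      show "\<forall>\<^sub>F n in sequentially. dist (birkhoff_sum T f n x / n) ?E < e"
        using up[OF elim(1) e] up[OF elim(2) e]
        by eventually_elim (auto simp: dist_real_def birkhoff_sum_def sum_negf)
    qed
  qed
qed

end


section \<open>Regret of exponential weights\<close>

text \<open>
  For losses in \<open>{0, 1}\<close> the factor \<open>exp (- \<eta> * l)\<close> is affine in \<open>l\<close>, so one round multiplies the
  total weight by exactly \<open>1 - (1 - exp (- \<eta>)) * L\<close>, where \<open>L\<close> is the weighted mean loss.  The rest is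
  \<open>1 - x \<le> exp (- x)\<close> and \<open>1 - exp (- \<eta>) \<ge> \<eta> - \<eta>^2 / 2\<close>.
\<close>

lemma exp_weights_step:
  fixes w l :: "'b \<Rightarrow> real"
  assumes fin: "finite I" and ne: "I \<noteq> {}" and w: "\<And>k. k \<in> I \<Longrightarrow> w k > 0"
    and l: "\<And>k. k \<in> I \<Longrightarrow> l k \<in> {0, 1}" and \<eta>: "\<eta> \<ge> 0"
  shows "(\<Sum>k\<in>I. w k * exp (- \<eta> * l k))
    \<le> (\<Sum>k\<in>I. w k) * exp (\<eta>^2 / 2 - \<eta> * ((\<Sum>k\<in>I. w k * l k) / (\<Sum>k\<in>I. w k)))"
proof -
  define W where "W = (\<Sum>k\<in>I. w k)"
  define L where "L = (\<Sum>k\<in>I. w k * l k) / W"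
  have W: "W > 0" unfolding W_def using fin ne w by (intro sum_pos)
  have L1: "L \<le> 1"
  proof -
    have "(\<Sum>k\<in>I. w k * l k) \<le> (\<Sum>k\<in>I. w k)"
      using w l by (intro sum_mono) (force simp: less_imp_le)
    then show ?thesis using W by (simp add: L_def W_def divide_le_eq)
  qed
  have "(\<Sum>k\<in>I. w k * exp (- \<eta> * l k)) = (\<Sum>k\<in>I. w k - (1 - exp (- \<eta>)) * (w k * l k))"
  proof (rule sum.cong)
    fix k assume "k \<in> I"
    then consider "l k = 0" | "l k = 1" using l by blast
    then show "w k * exp (- \<eta> * l k) = w k - (1 - exp (- \<eta>)) * (w k * l k)"
      by cases (auto simp: algebra_simps)
  qed simp
  also have "\<dots> = W * (1 - (1 - exp (- \<eta>)) * L)"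
  proof -
    have "W * L = (\<Sum>k\<in>I. w k * l k)" using W by (simp add: L_def)
    then show ?thesis
      by (simp only: sum_subtractf sum_distrib_left[symmetric] W_def[symmetric])
         (simp add: right_diff_distrib mult.left_commute[of W])
  qed
  also have "\<dots> \<le> W * exp (- ((1 - exp (- \<eta>)) * L))"
    using W exp_ge_add_one_self[of "- ((1 - exp (- \<eta>)) * L)"] by (intro mult_left_mono) auto
  also have "\<dots> \<le> W * exp (\<eta>^2 / 2 - \<eta> * L)"
  proof -
    have L0: "L \<ge> 0" unfolding L_def using W w l
      by (intro divide_nonneg_pos sum_nonneg mult_nonneg_nonneg) (force simp: less_imp_le)+
    have "exp (- \<eta>) \<le> 1 - \<eta> + \<eta>^2 / 2"
    proof -
      \<comment> \<open>\<open>exp \<eta> * (1 - \<eta> + \<eta>^2 / 2) \<ge> 1\<close> from the quadratic lower bound on \<open>exp \<eta>\<close>\<close>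
      have "1 + \<eta> + \<eta>^2 / 2 \<le> exp \<eta>" using exp_lower_Taylor_quadratic[OF \<eta>] by simp
      moreover have q: "1 - \<eta> + \<eta>^2 / 2 > 0"
      proof -
        have "1 - \<eta> + \<eta>^2 / 2 = ((1 - \<eta>)^2 + 1) / 2" by (simp add: power2_eq_square field_simps)
        then show ?thesis by (smt (verit) zero_le_power2 half_gt_zero)
      qed
      ultimately have "(1 + \<eta> + \<eta>^2 / 2) * (1 - \<eta> + \<eta>^2 / 2) \<le> exp \<eta> * (1 - \<eta> + \<eta>^2 / 2)"
        by (intro mult_right_mono) auto
      moreover have "(1 + \<eta> + \<eta>^2 / 2) * (1 - \<eta> + \<eta>^2 / 2) = 1 + (\<eta>^2/2)^2"
        by (simp add: power2_eq_square field_simps)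
      ultimately have "1 \<le> exp \<eta> * (1 - \<eta> + \<eta>^2 / 2)"
        by (smt (verit) zero_le_power2)
      then show ?thesis by (simp add: exp_minus field_simps)
    qed
    then have "(\<eta> - \<eta>^2 / 2) * L \<le> (1 - exp (- \<eta>)) * L" by (intro mult_right_mono L0) simp
    moreover have "\<eta>^2 / 2 * L \<le> \<eta>^2 / 2 * 1" by (intro mult_left_mono L1) simp
    ultimately have "- ((1 - exp (- \<eta>)) * L) \<le> \<eta>^2 / 2 - \<eta> * L" by (simp add: algebra_simps)
    then show ?thesis using W by simp
  qed
  finally show ?thesis unfolding L_def W_def .
qed

text \<open>
  The final total weight is at least the weight of expert \<open>k\<close>, and at most what iterating
  \<open>exp_weights_step\<close> allows; compare the logarithms.
\<close>

lemma exp_weights_regret: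
  fixes l :: "'b \<Rightarrow> nat \<Rightarrow> real"
  assumes fin: "finite I" and k: "k \<in> I"
    and l: "\<And>k i. k \<in> I \<Longrightarrow> l k i \<in> {0, 1}" and \<eta>: "\<eta> > 0"
    and w: "\<And>k i. k \<in> I \<Longrightarrow> a \<le> i \<Longrightarrow> i < a + n \<Longrightarrow> w i k = exp (- \<eta> * (\<Sum>j\<in>{a..<i}. l k j))"
  shows "(\<Sum>i\<in>{a..<a + n}. (\<Sum>k\<in>I. w i k * l k i) / (\<Sum>k\<in>I. w i k))
    \<le> (\<Sum>i\<in>{a..<a + n}. l k i) + ln (card I) / \<eta> + n * \<eta> / 2"
proof -
  define v where "v i k = exp (- \<eta> * (\<Sum>j\<in>{a..<i}. l k j))" for i k
  define Lb where "Lb i = (\<Sum>k\<in>I. v i k * l k i) / (\<Sum>k\<in>I. v i k)" for i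
  have ne: "I \<noteq> {}" using k by blast
  have upper: "(\<Sum>k\<in>I. v (a + n) k) \<le> card I * exp (n * (\<eta>^2 / 2) - \<eta> * (\<Sum>i\<in>{a..<a + n}. Lb i))" for n
  proof (induction n)
    case (Suc n)
    have "(\<Sum>k\<in>I. v (a + Suc n) k) = (\<Sum>k\<in>I. v (a + n) k * exp (- \<eta> * l k (a + n)))"
      by (simp add: v_def exp_add[symmetric] algebra_simps)
    also have "\<dots> \<le> (\<Sum>k\<in>I. v (a + n) k) * exp (\<eta>^2 / 2 - \<eta> * Lb (a + n))"
      unfolding Lb_def using \<eta> l by (intro exp_weights_step fin ne) (auto simp: v_def)
    also have "\<dots> \<le> (card I * exp (n * (\<eta>^2 / 2) - \<eta> * (\<Sum>i\<in>{a..<a + n}. Lb i)))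
        * exp (\<eta>^2 / 2 - \<eta> * Lb (a + n))"
      by (intro mult_right_mono Suc.IH) simp
    also have "\<dots> = card I * exp (Suc n * (\<eta>^2 / 2) - \<eta> * (\<Sum>i\<in>{a..<a + Suc n}. Lb i))"
      by (simp add: mult.assoc exp_add[symmetric] algebra_simps)
    finally show ?case .
  qed (simp add: v_def)
  have "exp (- \<eta> * (\<Sum>i\<in>{a..<a + n}. l k i)) = v (a + n) k" by (simp add: v_def)
  also have "\<dots> \<le> (\<Sum>k\<in>I. v (a + n) k)"
    using fin k by (intro member_le_sum) (auto simp: v_def)
  also note upper[of n]
  also have "card I * exp (n * (\<eta>^2 / 2) - \<eta> * (\<Sum>i\<in>{a..<a + n}. Lb i))
      = exp (ln (card I) + n * (\<eta>^2 / 2) - \<eta> * (\<Sum>i\<in>{a..<a + n}. Lb i))"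
    using fin ne by (simp add: exp_add exp_diff card_gt_0_iff)
  finally have "\<eta> * (\<Sum>i\<in>{a..<a + n}. Lb i) \<le> \<eta> * (\<Sum>i\<in>{a..<a + n}. l k i) + ln (card I) + n * (\<eta>^2 / 2)"
    by simp
  also have "\<dots> = \<eta> * ((\<Sum>i\<in>{a..<a + n}. l k i) + ln (card I) / \<eta> + n * \<eta> / 2)"
    using \<eta> by (simp add: field_simps power2_eq_square)
  finally have "(\<Sum>i\<in>{a..<a + n}. Lb i) \<le> (\<Sum>i\<in>{a..<a + n}. l k i) + ln (card I) / \<eta> + n * \<eta> / 2"
    using \<eta> by (simp only: mult_le_cancel_left_pos)
  moreover have "(\<Sum>i\<in>{a..<a + n}. (\<Sum>k\<in>I. w i k * l k i) / (\<Sum>k\<in>I. w i k)) = (\<Sum>i\<in>{a..<a + n}. Lb i)"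
    using w by (intro sum.cong) (auto simp: Lb_def v_def)
  ultimately show ?thesis by simp
qed

abbreviation past :: "(int \<Rightarrow> bool) \<Rightarrow> nat \<Rightarrow> bool list" where
  "past y n \<equiv> map y [1..int n - 1]"

definition mean_pred :: "nat \<Rightarrow> bool list \<Rightarrow> real" where
  "mean_pred n ys =
     (\<Sum>k = 1..2 ^ (floor_log n + 1). of_bool (markov_expert k n ys) * weight n k ys)
       / (\<Sum>k = 1..2 ^ (floor_log n + 1). weight n k ys)"

lemma scheme_eq: "scheme n ys u \<longleftrightarrow> u \<le> mean_pred n ys"
  by (simp add: scheme_def mean_pred_def Let_def not_less)

lemma weight_pos: "weight n k ys > 0"
  by (simp add: weight_def Let_def)

lemma weight_sum_pos: "(\<Sum>k = 1..2 ^ (m + 1). weight n k ys) > 0"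
  by (intro sum_pos weight_pos) auto

lemma mean_pred_range: "0 \<le> mean_pred n ys" "mean_pred n ys \<le> 1"
proof -
  show "0 \<le> mean_pred n ys" unfolding mean_pred_def
    by (intro divide_nonneg_nonneg sum_nonneg mult_nonneg_nonneg) (auto intro: less_imp_le weight_pos)
  have "(\<Sum>k = 1..2 ^ (floor_log n + 1). of_bool (markov_expert k n ys) * weight n k ys)
      \<le> (\<Sum>k = 1..2 ^ (floor_log n + 1). weight n k ys)"
    by (intro sum_mono mult_left_le_one_le) (auto intro: less_imp_le weight_pos)
  then show "mean_pred n ys \<le> 1" unfolding mean_pred_def
    using weight_sum_pos[where n=n and ys=ys and m="floor_log n"] by (simp only: divide_le_eq_1_pos)
qed

lemma nth_past: "1 \<le> i \<Longrightarrow> i < n \<Longrightarrow> past y n ! (i - 1) = y (int i)"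
  by (simp add: nth_upto)

lemma map_substr:
  assumes "1 \<le> a" "b < n"
  shows "substr (past y n) a b = map y [int a..int b]"
proof (rule nth_equalityI)
  show "length (substr (past y n) a b) = length (map y [int a..int b])"
    by (simp add: substr_def) arith
  fix i assume "i < length (substr (past y n) a b)"
  then show "substr (past y n) a b ! i = map y [int a..int b] ! i"
    using assms nth_past[of "a + i" n y]
    by (simp add: substr_def nth_upto del: upt_Suc split: if_splits)
qed

definition expert_err :: "nat \<Rightarrow> (int \<Rightarrow> bool) \<Rightarrow> nat \<Rightarrow> real" where
  "expert_err k y n = of_bool (markov_expert k n (past y n) \<noteq> y (int n))"

lemma weight_eq:
  assumes m: "2 ^ m \<le> n" "n < 2 ^ (m + 1)"
  shows "weight n k (past y n) = exp (- eta m * (\<Sum>i\<in>{2 ^ m..<n}. expert_err k y i))"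
proof -
  have n1: "n \<ge> 1" using m(1) one_le_power[of "2::nat" m] by linarith
  have fl: "floor_log n = m" using floor_log_block[OF n1] m by blast
  show ?thesis
  proof (cases "n = 2 ^ m")
    case True
    then show ?thesis by (simp add: weight_def fl)
  next
    case False
    then have lt: "2 ^ m < n" using m by simp
    have "(\<Sum>i = 2 ^ m..n - 1. of_bool (markov_expert k i (substr (past y n) 1 (i - 1)) \<noteq> past y n ! (i - 1)))
        = (\<Sum>i\<in>{2 ^ m..<n}. expert_err k y i)"
    proof (rule sum.cong)
      show "{2 ^ m..n - 1} = {2 ^ m..<n}" using n1 by auto
      fix i assume i: "i \<in> {2 ^ m..<n}"
      have "1 \<le> (2::nat) ^ m" by simp
      then have i1: "i \<ge> 1" using i by (simp only: atLeastLessThan_iff) linarith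
      have "substr (past y n) 1 (i - 1) = past y i"
        using i i1 by (subst map_substr) (auto simp: of_nat_diff)
      then show "of_bool (markov_expert k i (substr (past y n) 1 (i - 1)) \<noteq> past y n ! (i - 1))
          = expert_err k y i"
        using i i1 nth_past[of i n y] by (simp add: expert_err_def)
    qed
    then have "expert_loss (markov_expert k) (2 ^ m) (n - 1) (past y n)
        = (\<Sum>i\<in>{2 ^ m..<n}. expert_err k y i) / (real n - 2 ^ m)"
      using n1 by (simp add: expert_loss_def of_nat_diff)
    moreover have "real n - 2 ^ m > 0" using lt of_nat_less_iff[of "2^m" n, where 'a=real] by simp
    ultimately show ?thesis using False by (simp add: weight_def fl Let_def)
  qed
qed

text \<open>
  The probability, over the randomization only, that the scheme errs at time \<open>n\<close> on the path \<open>y\<close>.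
\<close>

definition mean_err :: "(int \<Rightarrow> bool) \<Rightarrow> nat \<Rightarrow> real" where
  "mean_err y n = \<bar>mean_pred n (past y n) - of_bool (y (int n))\<bar>"

text \<open>
  The error probability of the scheme is the weighted mean of the experts' errors, which is the
  quantity that \<open>exp_weights_regret\<close> controls.
\<close>

lemma mean_err_eq:
  "mean_err y n = (\<Sum>k = 1..2 ^ (floor_log n + 1). weight n k (past y n) * expert_err k y n)
     / (\<Sum>k = 1..2 ^ (floor_log n + 1). weight n k (past y n))"
proof -
  define I where "I = {1..(2::nat) ^ (floor_log n + 1)}"
  define W where "W = (\<Sum>k\<in>I. weight n k (past y n))"
  have W: "W > 0" unfolding W_def I_def by (rule weight_sum_pos)
  show ?thesis
  proof (cases "y (int n)")
    case False
    then have "mean_err y n = mean_pred n (past y n)"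
      using mean_pred_range(1)[of n "past y n"] by (simp add: mean_err_def)
    then show ?thesis using False
      by (simp add: mean_pred_def expert_err_def mult.commute)
  next
    case True
    have "mean_err y n = 1 - mean_pred n (past y n)"
      using True mean_pred_range(2)[of n "past y n"] by (simp add: mean_err_def)
    also have "mean_pred n (past y n)
        = (\<Sum>k\<in>I. weight n k (past y n) * of_bool (markov_expert k n (past y n))) / W"
      by (simp add: mean_pred_def I_def W_def mult.commute)
    also have "1 - \<dots> = (\<Sum>k\<in>I. weight n k (past y n) * (1 - of_bool (markov_expert k n (past y n)))) / W"
    proof -
      have "1 = W / W" using W by simp
      then show ?thesis
        by (simp only: right_diff_distrib sum_subtractf mult_1_right W_def[symmetric] diff_divide_distrib)
    qed
    also have "\<dots> = (\<Sum>k\<in>I. weight n k (past y n) * expert_err k y n) / W"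
      using True by (intro arg_cong[where f="\<lambda>x. x / W"] sum.cong) (auto simp: expert_err_def)
    finally show ?thesis by (simp add: I_def W_def)
  qed
qed

lemma ln_two_power_pos: "ln (2 ^ (m + 1) :: real) > 0"
  by (subst ln_realpow) auto

lemma eta_pos: "eta m > 0"
  unfolding eta_def using ln_two_power_pos[of m] by simp

lemma eta_sq: "(eta m)^2 = 8 * ln (2 ^ (m + 1)) / 2 ^ m"
  unfolding eta_def using ln_two_power_pos[of m] by (intro real_sqrt_pow2) simp

text \<open>
  The choice of \<open>eta m\<close> makes both error terms of \<open>exp_weights_regret\<close> at most \<open>2 ^ m * eta m / 2\<close>.
\<close>

lemma block_regret:
  assumes k: "k \<ge> 1" "k \<le> 2 ^ (m + 1)" and N: "N \<le> 2 ^ m"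
  shows "(\<Sum>i\<in>{2 ^ m..<2 ^ m + N}. mean_err y i) \<le> (\<Sum>i\<in>{2 ^ m..<2 ^ m + N}. expert_err k y i) + 2 ^ m * eta m"
proof -
  have fl: "floor_log i = m" if "i \<in> {2 ^ m..<2 ^ m + N}" for i
    using floor_log_block[of i m] that N one_le_power[of "2::nat" m] by (simp add: le_trans)
  have "(\<Sum>i\<in>{2 ^ m..<2 ^ m + N}. mean_err y i) =
      (\<Sum>i\<in>{2 ^ m..<2 ^ m + N}. (\<Sum>k = 1..2 ^ (m + 1). weight i k (past y i) * expert_err k y i)
     / (\<Sum>k = 1..2 ^ (m + 1). weight i k (past y i)))"
    by (intro sum.cong) (auto simp: mean_err_eq fl)
  also have "\<dots> \<le> (\<Sum>i\<in>{2 ^ m..<2 ^ m + N}. expert_err k y i)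
      + ln (card {1..(2::nat) ^ (m + 1)}) / eta m + N * eta m / 2"
    by (rule exp_weights_regret) (use k N in \<open>auto simp: expert_err_def eta_pos weight_eq\<close>)
  also have "ln (card {1..(2::nat) ^ (m + 1)}) / eta m \<le> 2 ^ m * eta m / 2"
  proof -
    have "ln (2 ^ (m + 1)) = (eta m)^2 * 2 ^ m / 8" by (simp add: eta_sq)
    then have "ln (card {1..(2::nat) ^ (m + 1)}) = (2 ^ m * eta m / 8) * eta m"
      by (simp add: power2_eq_square)
    then have "ln (card {1..(2::nat) ^ (m + 1)}) / eta m = 2 ^ m * eta m / 8"
      using eta_pos[of m] by (simp only: nonzero_mult_div_cancel_right)
    moreover have "2 ^ m * eta m / 8 \<le> 2 ^ m * eta m / 2" using eta_pos[of m] by simp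
    ultimately show ?thesis by (simp only:)
  qed
  also have "N * eta m / 2 \<le> 2 ^ m * eta m / 2"
    using N of_nat_mono[OF N, where 'a=real] eta_pos[of m] by (intro divide_right_mono mult_right_mono) auto
  finally show ?thesis by (simp add: ac_simps)
qed

lemma expert_err_nonneg: "expert_err k y n \<ge> 0" by (simp add: expert_err_def)

lemma mean_err_range: "0 \<le> mean_err y n" "mean_err y n \<le> 1"
  unfolding mean_err_def using mean_pred_range[of n "past y n"] by (cases "y (int n)"; simp)+

text \<open>
  Expert \<open>k\<close> takes no part in the early blocks, but those have fewer than \<open>k\<close> rounds each.
\<close>

lemma block_regret_any_expert:
  assumes k: "k \<ge> 1" and N: "N \<le> 2 ^ m"
  shows "(\<Sum>i\<in>{2 ^ m..<2 ^ m + N}. mean_err y i)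
    \<le> (\<Sum>i\<in>{2 ^ m..<2 ^ m + N}. expert_err k y i) + (2 ^ m * eta m + k)"
proof (cases "k \<le> 2 ^ (m + 1)")
  case True
  then show ?thesis using block_regret[OF k True N, of y] by simp
next
  case False
  then have "2 ^ m < k" by simp
  have "(\<Sum>i\<in>{2 ^ m..<2 ^ m + N}. mean_err y i) \<le> (\<Sum>i\<in>{2 ^ m..<2 ^ m + N}. 1)"
    by (intro sum_mono mean_err_range)
  also have "\<dots> \<le> k" using N \<open>2 ^ m < k\<close> by simp
  moreover have "0 \<le> (\<Sum>i\<in>{2 ^ m..<2 ^ m + N}. expert_err k y i)" by (intro sum_nonneg expert_err_nonneg)
  moreover have "0 \<le> 2 ^ m * eta m" using eta_pos[of m] by simp
  ultimately show ?thesis by simp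
qed

lemma full_regret:
  assumes k: "k \<ge> 1" and N: "N \<le> 2 ^ m"
  shows "(\<Sum>i\<in>{1..<2 ^ m + N}. mean_err y i)
    \<le> (\<Sum>i\<in>{1..<2 ^ m + N}. expert_err k y i) + (\<Sum>j\<le>m. 2 ^ j * eta j + k)"
  using N
proof (induction m arbitrary: N)
  case 0
  then show ?case using block_regret_any_expert[OF k, of N 0 y] by simp
next
  case (Suc m)
  have split: "(\<Sum>i\<in>{1..<2 ^ Suc m + N}. f i)
      = (\<Sum>i\<in>{1..<2 ^ m + 2 ^ m}. f i) + (\<Sum>i\<in>{2 ^ Suc m..<2 ^ Suc m + N}. f i)" for f :: "nat \<Rightarrow> real"
  proof -
    have "1 \<le> (2::nat) ^ Suc m" by (rule one_le_power) simp
    then have "(\<Sum>i\<in>{1..<2 ^ Suc m + N}. f i)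
        = (\<Sum>i\<in>{1..<2 ^ Suc m}. f i) + (\<Sum>i\<in>{2 ^ Suc m..<2 ^ Suc m + N}. f i)"
      by (intro sum.atLeastLessThan_concat[symmetric]) auto
    moreover have "(2::nat) ^ Suc m = 2 ^ m + 2 ^ m" by simp
    ultimately show ?thesis by metis
  qed
  show ?case
    unfolding split using Suc.IH[of "2 ^ m"] block_regret_any_expert[OF k Suc.prems, of y] by simp
qed

text \<open>
  Each of the \<open>m + 1\<close> blocks up to time \<open>2 ^ (m + 1)\<close> costs at most \<open>sqrt (8 * (m + 1) * 2 ^ m) + k\<close>.
\<close>

lemma regret_vanishes:
  "(\<lambda>m. (\<Sum>j\<le>m. 2 ^ j * eta j + real k) / 2 ^ m) \<longlonglongrightarrow> 0"
proof (rule Lim_null_comparison)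
  have bound: "2 ^ j * eta j \<le> sqrt (8 * (real m + 1) * 2 ^ m)" if "j \<le> m" for j m
  proof (rule real_le_rsqrt)
    have "ln (2 ^ (j + 1)) = real (j + 1) * ln 2" by (rule ln_realpow)
    also have "\<dots> \<le> real (j + 1) * 1" using ln2_le_25_over_36 by (intro mult_left_mono) auto
    finally have l: "ln (2 ^ (j + 1)) \<le> real m + 1" using that by simp
    have "(2 ^ j * eta j)^2 = 8 * ln (2 ^ (j + 1)) * 2 ^ j"
      by (simp add: power_mult_distrib eta_sq) (simp add: power2_eq_square)
    also have "\<dots> \<le> 8 * (real m + 1) * 2 ^ m"
      using l that ln_two_power_pos[of j] by (intro mult_mono) (auto simp: less_imp_le)
    finally show "(2 ^ j * eta j)^2 \<le> 8 * (real m + 1) * 2 ^ m" .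
  qed
  show "\<forall>\<^sub>F m in sequentially. norm ((\<Sum>j\<le>m. 2 ^ j * eta j + real k) / 2 ^ m)
      \<le> (real m + 1) * (sqrt (8 * (real m + 1) * 2 ^ m) + real k) / 2 ^ m"
  proof (intro always_eventually allI)
    fix m
    have "(\<Sum>j\<le>m. 2 ^ j * eta j + real k) \<le> (\<Sum>j\<le>m. sqrt (8 * (real m + 1) * 2 ^ m) + real k)"
      by (intro sum_mono add_mono bound) auto
    moreover have "0 \<le> (\<Sum>j\<le>m. 2 ^ j * eta j + real k)"
      using eta_pos by (intro sum_nonneg add_nonneg_nonneg) (auto simp: less_imp_le)
    ultimately show "norm ((\<Sum>j\<le>m. 2 ^ j * eta j + real k) / 2 ^ m)
        \<le> (real m + 1) * (sqrt (8 * (real m + 1) * 2 ^ m) + real k) / 2 ^ m"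
      by (auto intro!: divide_right_mono simp: add.commute)
  qed
  show "(\<lambda>m. (real m + 1) * (sqrt (8 * (real m + 1) * 2 ^ m) + real k) / 2 ^ m) \<longlonglongrightarrow> 0"
    by real_asymp
qed

proposition scheme_tracks_expert:
  assumes k: "k \<ge> 1" and e: "e > 0"
  shows "\<forall>\<^sub>F n in sequentially. (\<Sum>i = 1..n. mean_err y i) / n \<le> (\<Sum>i = 1..n. expert_err k y i) / n + e"
proof -
  define R where "R m = (\<Sum>j\<le>m. 2 ^ j * eta j + real k)" for m
  have "(\<lambda>m. R m / 2 ^ m) \<longlonglongrightarrow> 0" unfolding R_def by (rule regret_vanishes)
  from order_tendstoD(2)[OF this e]
  obtain m0 where m0: "\<And>m. m \<ge> m0 \<Longrightarrow> R m / 2 ^ m < e"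
    unfolding eventually_sequentially by blast
  show ?thesis
  proof (rule eventually_sequentiallyI)
    fix n :: nat assume n: "n \<ge> 2 ^ m0"
    then have n1: "n \<ge> 1" using one_le_power[of "2::nat" m0] by linarith
    define m where "m = floor_log n"
    have m: "2 ^ m \<le> n" "n < 2 ^ (m + 1)" using floor_log_block[OF n1, of m] by (auto simp: m_def)
    have "2 ^ m0 < (2::nat) ^ (m + 1)" using n m by linarith
    then have "m0 < m + 1" by (rule power_less_imp_less_exp[rotated]) simp
    then have "m0 \<le> m" by simp
    have "(\<Sum>i\<in>{1..<2 ^ m + (n + 1 - 2 ^ m)}. mean_err y i)
        \<le> (\<Sum>i\<in>{1..<2 ^ m + (n + 1 - 2 ^ m)}. expert_err k y i) + R m"
      unfolding R_def by (rule full_regret[OF k]) (use m in auto)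
    moreover have "{1..<2 ^ m + (n + 1 - 2 ^ m)} = {1..n}" using m by auto
    ultimately have "(\<Sum>i = 1..n. mean_err y i) \<le> (\<Sum>i = 1..n. expert_err k y i) + R m" by simp
    then have "(\<Sum>i = 1..n. mean_err y i) / n \<le> (\<Sum>i = 1..n. expert_err k y i) / n + R m / n"
      by (simp add: divide_right_mono flip: add_divide_distrib)
    moreover have "R m / n \<le> R m / 2 ^ m"
    proof (rule divide_left_mono)
      show "2 ^ m \<le> real n" using of_nat_mono[OF m(1), where 'a=real] by simp
      show "0 \<le> R m" unfolding R_def using eta_pos
        by (intro sum_nonneg add_nonneg_nonneg) (auto simp: less_imp_le)
    qed (use n1 in auto)
    moreover have "R m / 2 ^ m < e" by (rule m0) fact
    ultimately show "(\<Sum>i = 1..n. mean_err y i) / n \<le> (\<Sum>i = 1..n. expert_err k y i) / n + e" by linarith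
  qed
qed


section \<open>Approximation by finite windows\<close>

text \<open>
  The sets that can be approximated by members of the algebra form a \<open>\<sigma>\<close>-algebra: a countable union
  is close to one of its finite partial unions, which is approximated term by term.
\<close>

lemma (in finite_measure) algebra_approximates_sigma_algebra:
  assumes G: "algebra (space M) G" "G \<subseteq> sets M"
    and A: "A \<in> sigma_sets (space M) G" and e: "e > 0"
  shows "\<exists>C\<in>G. measure M ((A - C) \<union> (C - A)) < e"
  using A e
proof (induction arbitrary: e rule: sigma_sets.induct)
  case (Basic a)
  then show ?case by (intro bexI[of _ a]) auto
next
  case Empty
  interpret algebra "space M" G by fact
  show ?case using Empty by (intro bexI[of _ "{}"]) auto
next
  case (Compl a)
  interpret algebra "space M" G by fact
  obtain C where C: "C \<in> G" "measure M ((a - C) \<union> (C - a)) < e"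
    using Compl.IH[OF Compl.prems] by blast
  have "a \<subseteq> space M" using Compl.hyps sigma_sets_into_sp[OF space_closed] by blast
  moreover have "C \<subseteq> space M" using C(1) space_closed by blast
  ultimately have "(space M - a - (space M - C)) \<union> (space M - C - (space M - a)) = (a - C) \<union> (C - a)"
    by blast
  then show ?case using C by (intro bexI[of _ "space M - C"]) auto
next
  case (Union a)
  interpret algebra "space M" G by fact
  have sM: "sigma_sets (space M) G \<subseteq> sets M" using G(2) by (rule sets.sigma_sets_subset)
  have aM[measurable]: "a i \<in> sets M" for i using Union.hyps sM by blast
  have GM: "C \<in> sets M" if "C \<in> G" for C using G(2) that by blast
  have finite_union: "\<exists>C\<in>G. measure M (((\<Union>i<n. a i) - C) \<union> (C - (\<Union>i<n. a i))) < e" if "e > 0" for n e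
    using that
  proof (induction n arbitrary: e)
    case 0
    then show ?case by (intro bexI[of _ "{}"]) auto
  next
    case (Suc n)
    obtain C where C: "C \<in> G" "measure M (((\<Union>i<n. a i) - C) \<union> (C - (\<Union>i<n. a i))) < e / 2"
      using Suc.IH[of "e / 2"] Suc.prems by auto
    obtain D where D: "D \<in> G" "measure M ((a n - D) \<union> (D - a n)) < e / 2"
      using Union.IH[of "e / 2" n] Suc.prems by auto
    note [measurable] = GM[OF C(1)] GM[OF D(1)]
    let ?X = "((\<Union>i<n. a i) - C) \<union> (C - (\<Union>i<n. a i))" and ?Y = "(a n - D) \<union> (D - a n)"
    have "measure M (((\<Union>i<Suc n. a i) - (C \<union> D)) \<union> ((C \<union> D) - (\<Union>i<Suc n. a i))) \<le> measure M (?X \<union> ?Y)"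
      by (intro finite_measure_mono) (auto simp: lessThan_Suc)
    also have "\<dots> \<le> measure M ?X + measure M ?Y" by (intro measure_Un_le) auto
    also have "\<dots> < e" using C D by simp
    finally show ?case using C D by (intro bexI[of _ "C \<union> D"]) auto
  qed
  let ?B = "\<Union>i. a i" and ?P = "\<lambda>n. \<Union>i<n. a i"
  have "(\<lambda>n. measure M (?P n)) \<longlonglongrightarrow> measure M (\<Union>n. ?P n)"
  proof (rule finite_Lim_measure_incseq)
    show "incseq ?P" by (intro monoI UN_mono) auto
  qed auto
  moreover have "(\<Union>n. ?P n) = ?B" by blast
  ultimately have "(\<lambda>n. measure M (?P n)) \<longlonglongrightarrow> measure M ?B" by simp
  then have "\<forall>\<^sub>F n in sequentially. measure M (?P n) > measure M ?B - e / 2"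
    by (rule order_tendstoD) (use Union.prems in simp)
  then obtain n where n: "measure M (?P n) > measure M ?B - e / 2"
    by (auto simp: eventually_sequentially)
  obtain C where C: "C \<in> G" "measure M ((?P n - C) \<union> (C - ?P n)) < e / 2"
    using finite_union[of "e / 2" n] Union.prems by auto
  note [measurable] = GM[OF C(1)]
  have "measure M ((?B - C) \<union> (C - ?B)) \<le> measure M ((?B - ?P n) \<union> ((?P n - C) \<union> (C - ?P n)))"
    by (intro finite_measure_mono) auto
  also have "\<dots> \<le> measure M (?B - ?P n) + measure M ((?P n - C) \<union> (C - ?P n))"
    by (intro measure_Un_le) auto
  also have "measure M (?B - ?P n) = measure M ?B - measure M (?P n)"
    by (intro finite_measure_Diff) auto
  finally show ?case using C n by (intro bexI[of _ C]) auto
qed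

definition shift_by :: "int \<Rightarrow> (int \<Rightarrow> bool) \<Rightarrow> int \<Rightarrow> bool" where
  "shift_by j y = (\<lambda>n. y (n + j))"

lemma shift_by_shift_by: "shift_by i (shift_by j y) = shift_by (i + j) y"
  by (simp add: shift_by_def add.assoc)

lemma shift_by_0[simp]: "shift_by 0 y = y" by (simp add: shift_by_def)

lemma shift_by_apply[simp]: "shift_by j y n = y (n + j)" by (simp add: shift_by_def)

lemma funpow_shift_by: "shift_by 1 ^^ i = shift_by (int i)"
proof (induction i)
  case (Suc i)
  then show ?case by (simp add: fun_eq_iff add.assoc)
qed (simp add: fun_eq_iff)

text \<open>
  The events of path space that depend on the coordinates with negative index only.
\<close>

definition path_past :: "(int \<Rightarrow> bool) measure" where
  "path_past = past_algebra path_space (\<lambda>n y. y n)"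

lemma space_path_past[simp]: "space path_past = UNIV"
  by (simp add: path_past_def past_algebra_def space_PiM)

lemma coord_past_measurable: "n < 0 \<Longrightarrow> (\<lambda>y. y n) \<in> path_past \<rightarrow>\<^sub>M count_space UNIV"
proof -
  assume n: "n < 0"
  have "(\<lambda>y. \<lambda>n\<in>{..<0}. y n) \<in> path_past \<rightarrow>\<^sub>M Pi\<^sub>M {..<0::int} (\<lambda>_. count_space (UNIV :: bool set))"
    unfolding path_past_def past_algebra_def
    by (rule measurable_vimage_algebra1) (auto simp: space_PiM)
  from measurable_compose[OF this measurable_component_singleton[of n]] n show ?thesis by simp
qed

lemma measurable_path_pastI:
  assumes "\<And>n. n < 0 \<Longrightarrow> (\<lambda>x. g x n) \<in> N \<rightarrow>\<^sub>M count_space UNIV"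
  shows "g \<in> N \<rightarrow>\<^sub>M path_past"
  unfolding path_past_def past_algebra_def
  by (rule measurable_vimage_algebra2) (auto simp: space_PiM intro!: measurable_restrict assms)

lemma shift_by_past_measurable: "d \<le> 0 \<Longrightarrow> shift_by d \<in> path_past \<rightarrow>\<^sub>M path_past"
  by (intro measurable_path_pastI) (auto intro!: coord_past_measurable)

lemma measurable_map_list:
  assumes "\<And>n. n \<in> set xs \<Longrightarrow> (\<lambda>x. g x n) \<in> N \<rightarrow>\<^sub>M count_space UNIV"
  shows "(\<lambda>x. map (g x) xs) \<in> N \<rightarrow>\<^sub>M count_space (UNIV :: bool list set)"
proof -
  have "{x \<in> space N. map (g x) xs = l} \<in> sets N" for l
    using assms
  proof (induction xs arbitrary: l)
    case Nil
    then show ?case by (cases l) auto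
  next
    case (Cons n xs)
    show ?case
    proof (cases l)
      case l: (Cons b l')
      have "{x \<in> space N. map (g x) (n # xs) = l}
          = ((\<lambda>x. g x n) -` {b} \<inter> space N) \<inter> {x \<in> space N. map (g x) xs = l'}"
        unfolding l by auto
      also have "\<dots> \<in> sets N"
        using Cons.IH[of l'] Cons.prems by (intro sets.Int measurable_sets) auto
      finally show ?thesis .
    qed simp
  qed
  moreover have "(\<lambda>x. map (g x) xs) -` {l} \<inter> space N = {x \<in> space N. map (g x) xs = l}" for l by auto
  ultimately show ?thesis by (simp add: measurable_count_space_eq_countable)
qed

definition ctx :: "nat \<Rightarrow> (int \<Rightarrow> bool) \<Rightarrow> bool list" where
  "ctx k y = map y [- int k..-1]"

lemma ctx_measurable: "ctx k \<in> path_past \<rightarrow>\<^sub>M count_space UNIV"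
  unfolding ctx_def[abs_def] by (rule measurable_map_list) (auto intro: coord_past_measurable)

lemma length_ctx[simp]: "length (ctx k y) = k" by (simp add: ctx_def)

text \<open>
  The events that depend on finitely many past coordinates.
\<close>

definition window_sets :: "(int \<Rightarrow> bool) set set" where
  "window_sets = {C. \<exists>k. \<forall>y y'. ctx k y = ctx k y' \<longrightarrow> (y \<in> C \<longleftrightarrow> y' \<in> C)}"

lemma ctx_mono: "k \<le> k' \<Longrightarrow> ctx k' y = ctx k' y' \<Longrightarrow> ctx k y = ctx k y'"
  unfolding ctx_def map_eq_conv set_upto by auto

lemma algebra_window_sets: "algebra UNIV window_sets"
  unfolding algebra_iff_Un
proof (intro conjI ballI)
  show "{} \<in> window_sets" by (simp add: window_sets_def)
  fix a assume a: "a \<in> window_sets"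
  then show "UNIV - a \<in> window_sets" by (simp add: window_sets_def)
  fix b assume b: "b \<in> window_sets"
  obtain k k' where k: "\<And>y y'. ctx k y = ctx k y' \<longrightarrow> (y \<in> a \<longleftrightarrow> y' \<in> a)"
      "\<And>y y'. ctx k' y = ctx k' y' \<longrightarrow> (y \<in> b \<longleftrightarrow> y' \<in> b)"
    using a b unfolding window_sets_def by blast
  have "\<forall>y y'. ctx (max k k') y = ctx (max k k') y' \<longrightarrow> (y \<in> a \<union> b \<longleftrightarrow> y' \<in> a \<union> b)"
  proof (intro allI impI)
    fix y y' assume "ctx (max k k') y = ctx (max k k') y'"
    then have "ctx k y = ctx k y'" "ctx k' y = ctx k' y'"
      using ctx_mono[of k "max k k'" y y'] ctx_mono[of k' "max k k'" y y'] by simp_all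
    then show "y \<in> a \<union> b \<longleftrightarrow> y' \<in> a \<union> b" using k by blast
  qed
  then show "a \<union> b \<in> window_sets" unfolding window_sets_def by blast
qed simp

lemma window_setE:
  assumes "C \<in> window_sets"
  obtains k S where "k \<ge> 1" "C = {y. ctx k y \<in> S}"
proof -
  obtain k where k: "\<And>y y'. ctx k y = ctx k y' \<longrightarrow> (y \<in> C \<longleftrightarrow> y' \<in> C)"
    using assms unfolding window_sets_def by blast
  have k': "y \<in> C \<longleftrightarrow> y' \<in> C" if "ctx (Suc k) y = ctx (Suc k) y'" for y y'
  proof -
    have "ctx k y = ctx k y'" by (rule ctx_mono[OF _ that]) simp
    then show ?thesis using k by blast
  qed
  have "C = {y. ctx (Suc k) y \<in> ctx (Suc k) ` C}"
  proof (intro set_eqI iffI CollectI)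
    fix y assume "y \<in> {y. ctx (Suc k) y \<in> ctx (Suc k) ` C}"
    then obtain y' where "y' \<in> C" "ctx (Suc k) y = ctx (Suc k) y'" by blast
    then show "y \<in> C" using k' by blast
  qed blast
  then show ?thesis by (rule that[rotated]) simp
qed

lemma path_past_subset_window: "sets path_past \<subseteq> sigma_sets UNIV window_sets"
proof -
  have "(\<lambda>y. y) \<in> sigma UNIV window_sets \<rightarrow>\<^sub>M path_past"
  proof (rule measurable_path_pastI)
    fix n :: int assume n: "n < 0"
    have coord: "y n = y' n" if "ctx (nat (- n)) y = ctx (nat (- n)) y'" for y y' :: "int \<Rightarrow> bool"
      using n that unfolding ctx_def map_eq_conv set_upto by simp
    have "(\<lambda>y. y n) -` A \<in> window_sets" for A
      unfolding window_sets_def vimage_def mem_Collect_eq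
    proof (intro exI[of _ "nat (- n)"] allI impI)
      fix y y' :: "int \<Rightarrow> bool" assume "ctx (nat (- n)) y = ctx (nat (- n)) y'"
      then have "y n = y' n" by (rule coord)
      then show "(y n \<in> A) = (y' n \<in> A)" by (rule arg_cong)
    qed
    then show "(\<lambda>y. y n) \<in> sigma UNIV window_sets \<rightarrow>\<^sub>M count_space UNIV"
      unfolding measurable_def by (simp add: sigma_sets.Basic)
  qed
  then have "(\<lambda>y. y) -` A \<inter> space (sigma UNIV window_sets) \<in> sets (sigma UNIV window_sets)"
    if "A \<in> sets path_past" for A
    using that by (rule measurable_sets)
  then show ?thesis by (simp add: subset_iff)
qed

section \<open>The conditional probability of the next symbol\<close>

locale ergodic_path = prob_space \<mu> for \<mu> :: "(int \<Rightarrow> bool) measure" +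
  assumes sets_path[measurable_cong]: "sets \<mu> = sets path_space"
    and shift_invariant: "distr \<mu> \<mu> (shift_by 1) = \<mu>"
    and shift_ergodic: "\<And>A. A \<in> sets path_space \<Longrightarrow> shift_by 1 -` A = A \<Longrightarrow> measure \<mu> A \<in> {0, 1}"
begin

lemma space_path[simp]: "space \<mu> = UNIV"
  using sets_eq_imp_space_eq[OF sets_path] by (simp add: space_PiM)

lemma coord_measurable[measurable]: "(\<lambda>y. y n) \<in> \<mu> \<rightarrow>\<^sub>M count_space UNIV"
  unfolding measurable_cong_sets[OF sets_path refl] by (rule measurable_component_singleton) simp

lemma shift_by_measurable[measurable]: "shift_by j \<in> \<mu> \<rightarrow>\<^sub>M \<mu>"
  unfolding measurable_cong_sets[OF refl sets_path] shift_by_def[abs_def]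
  by (rule measurable_PiM_single') (auto simp: space_PiM)

sublocale ergodic_map \<mu> "shift_by 1"
proof
  show "prob A = 0 \<or> prob A = 1" if "A \<in> sets \<mu>" "shift_by 1 -` A \<inter> space \<mu> = A" for A
    using shift_ergodic[of A] that by (simp add: sets_path)
qed (auto simp: shift_invariant)

lemma AE_shift_by: "AE y in \<mu>. P y \<Longrightarrow> AE y in \<mu>. P (shift_by 1 y)"
  by (rule AE_distrD[OF shift_by_measurable[of 1]]) (simp only: shift_invariant)

lemma integral_shift_by:
  fixes f :: "(int \<Rightarrow> bool) \<Rightarrow> real"
  shows "f \<in> borel_measurable \<mu> \<Longrightarrow> (\<integral>y. f (shift_by (int i) y) \<partial>\<mu>) = (\<integral>y. f y \<partial>\<mu>)"
  using integral_funpow_T[of f i] by (simp add: funpow_shift_by)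

lemma birkhoff_path:
  fixes f :: "(int \<Rightarrow> bool) \<Rightarrow> real"
  assumes f: "f \<in> borel_measurable \<mu>" and bnd: "\<And>y. \<bar>f y\<bar> \<le> C"
  shows "AE y in \<mu>. (\<lambda>n. (\<Sum>i = 1..n. f (shift_by (int i) y)) / n) \<longlonglongrightarrow> (\<integral>y. f y \<partial>\<mu>)"
proof -
  have "birkhoff_sum (shift_by 1) f n (shift_by 1 y) = (\<Sum>i = 1..n. f (shift_by (int i) y))" for n y
  proof -
    have "(\<Sum>i = 1..n. f (shift_by (int i) y)) = (\<Sum>i<n. f (shift_by (int (Suc i)) y))"
      by (rule sum.reindex_bij_witness[of _ Suc "\<lambda>i. i - 1"]) auto
    then show ?thesis by (simp add: birkhoff_sum_def funpow_shift_by shift_by_shift_by add.commute)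
  qed
  then show ?thesis using AE_shift_by[OF birkhoff[OF f bnd]] by simp
qed

lemma path_past_subalgebra: "subalgebra \<mu> path_past"
proof -
  have "(\<lambda>y. y) \<in> \<mu> \<rightarrow>\<^sub>M path_past" by (rule measurable_path_pastI) measurable
  then have "sets path_past \<subseteq> sets \<mu>"
    using measurable_sets[of "\<lambda>y. y" \<mu> path_past] by auto
  then show ?thesis by (simp add: subalgebra_def)
qed

lemma past_measurable_imp: "f \<in> path_past \<rightarrow>\<^sub>M N \<Longrightarrow> f \<in> \<mu> \<rightarrow>\<^sub>M N"
  using path_past_subalgebra by (rule measurable_from_subalg)

sublocale past: finite_measure_subalgebra \<mu> path_past
  by unfold_locales (rule path_past_subalgebra)

text \<open>
  Truncation to \<open>[0, 1]\<close> changes the conditional expectation on a null set only, and makes the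
  bounds hold for every path.
\<close>

definition true_prob :: "(int \<Rightarrow> bool) \<Rightarrow> real" where
  "true_prob y = max 0 (min 1 (real_cond_exp \<mu> path_past (\<lambda>y. of_bool (y 0)) y))"

lemma true_prob_range: "0 \<le> true_prob y" "true_prob y \<le> 1" by (auto simp: true_prob_def)

lemma true_prob_past_measurable[measurable]: "true_prob \<in> borel_measurable path_past"
  unfolding true_prob_def[abs_def] by measurable

lemma true_prob_measurable[measurable]: "true_prob \<in> borel_measurable \<mu>"
  by (rule past_measurable_imp) measurable

lemma integral_true_prob:
  assumes Z: "Z \<in> borel_measurable path_past" and bnd: "\<And>y. \<bar>Z y\<bar> \<le> C"
  shows "(\<integral>y. Z y * of_bool (y 0) \<partial>\<mu>) = (\<integral>y. Z y * true_prob y \<partial>\<mu>)"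
proof -
  have [measurable]: "Z \<in> borel_measurable \<mu>" using Z by (rule past_measurable_imp)
  have [measurable]: "(\<lambda>y. of_bool (y 0) :: real) \<in> borel_measurable \<mu>" by measurable
  have int0: "integrable \<mu> (\<lambda>y. of_bool (y 0) :: real)"
    by (rule integrable_const_bound[where B=1]) auto
  have "AE y in \<mu>. real_cond_exp \<mu> path_past (\<lambda>y. of_bool (y 0)) y \<ge> 0"
    by (rule past.real_cond_exp_ge_c[OF int0]) simp
  moreover have "AE y in \<mu>. real_cond_exp \<mu> path_past (\<lambda>y. of_bool (y 0)) y \<le> 1"
    by (rule past.real_cond_exp_le_c[OF int0]) simp
  ultimately have ce: "AE y in \<mu>. true_prob y = real_cond_exp \<mu> path_past (\<lambda>y. of_bool (y 0)) y"
    by eventually_elim (simp add: true_prob_def)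
  have "\<bar>Z y * of_bool (y 0)\<bar> \<le> C" for y
    using bnd[of y] by (cases "y 0") auto
  then have "integrable \<mu> (\<lambda>y. Z y * of_bool (y 0))"
    by (intro integrable_const_bound[where B=C]) auto
  then have "(\<integral>y. Z y * of_bool (y 0) \<partial>\<mu>) = (\<integral>y. Z y * real_cond_exp \<mu> path_past (\<lambda>y. of_bool (y 0)) y \<partial>\<mu>)"
    by (rule past.real_cond_exp_intg(2)[symmetric]) (auto simp: Z)
  also have "\<dots> = (\<integral>y. Z y * true_prob y \<partial>\<mu>)"
    by (rule integral_cong_AE) (use ce in auto)
  finally show ?thesis .
qed

text \<open>
  The conditional mean, given the past, of the error probability at time \<open>i\<close> of a predictor that
  votes for 1 with probability \<open>q i\<close>.
\<close>

definition cond_err :: "(nat \<Rightarrow> bool list \<Rightarrow> real) \<Rightarrow> nat \<Rightarrow> (int \<Rightarrow> bool) \<Rightarrow> real" where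
  "cond_err q i y = q i (past y i) + (1 - 2 * q i (past y i)) * true_prob (shift_by (int i) y)"

text \<open>
  The difference at time \<open>j\<close> is the symbol centered by \<open>true_prob\<close>, times a function of the past.  Times an
  earlier difference it is still the centered symbol times a function of the past, and so has
  expectation 0.
\<close>

lemma err_minus_cond_err_vanishes:
  assumes q: "\<And>i l. 0 \<le> q i l \<and> q i l \<le> 1"
  shows "AE y in \<mu>. (\<lambda>n. (\<Sum>i = 1..n. \<bar>q i (past y i) - of_bool (y (int i))\<bar> - cond_err q i y) / n) \<longlonglongrightarrow> 0"
proof -
  define D where "D i y = (1 - 2 * q i (past y i)) * (of_bool (y (int i)) - true_prob (shift_by (int i) y))" for i y
  have q2: "\<bar>1 - 2 * q i l\<bar> \<le> 1" for i l using q[of i l] by auto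
  have D_eq: "\<bar>q i (past y i) - of_bool (y (int i))\<bar> - cond_err q i y = D i y" for i y
    using q[of i "past y i"] by (cases "y (int i)") (auto simp: D_def cond_err_def algebra_simps)
  have D_bnd: "\<bar>D i y\<bar> \<le> 1" for i y
    unfolding D_def abs_mult
    by (rule mult_le_one) (use q2 true_prob_range[of "shift_by (int i) y"] in \<open>auto simp: abs_le_iff of_bool_def\<close>)
  have cm: "(\<lambda>y. q i (past y i)) \<in> borel_measurable \<mu>" for i
    by (rule measurable_compose[OF measurable_map_list]) auto
  have D_meas[measurable]: "D i \<in> borel_measurable \<mu>" for i
    unfolding D_def[abs_def] using cm by measurable
  have "AE y in \<mu>. (\<lambda>n. (\<Sum>i = 1..n. D i y) / n) \<longlonglongrightarrow> 0"
  proof (rule slln_orthogonal)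
    fix i j :: nat assume ij: "1 \<le> i" "i < j"
    \<comment> \<open>Seen from time \<open>j\<close> as the new origin, \<open>Z\<close> is the part of the product that the past determines.\<close>
    define Z where "Z y = D i (shift_by (- int j) y) * (1 - 2 * q j (past (shift_by (- int j) y) j))" for y
    have Zbnd: "\<bar>Z y\<bar> \<le> 1" for y
      unfolding Z_def abs_mult by (rule mult_le_one) (auto simp: D_bnd q2)
    have qm: "(\<lambda>y. q l (past (shift_by (- int j) y) l)) \<in> borel_measurable path_past" if "l \<le> j" for l
      by (rule measurable_compose[OF measurable_map_list])
         (use that in \<open>auto intro!: coord_past_measurable\<close>)
    have true_prob': "(\<lambda>y. true_prob (shift_by (int i - int j) y)) \<in> borel_measurable path_past"
      by (rule measurable_compose[OF shift_by_past_measurable true_prob_past_measurable]) (use ij in simp)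
    have y': "(\<lambda>y. y (int i - int j)) \<in> path_past \<rightarrow>\<^sub>M count_space UNIV"
      using ij by (intro coord_past_measurable) simp
    have Z_eq: "Z = (\<lambda>y. (1 - 2 * q i (past (shift_by (- int j) y) i))
        * (of_bool (y (int i - int j)) - true_prob (shift_by (int i - int j) y))
        * (1 - 2 * q j (past (shift_by (- int j) y) j)))"
      by (simp add: fun_eq_iff Z_def D_def shift_by_shift_by)
    have Zm: "Z \<in> borel_measurable path_past"
      unfolding Z_eq using ij
      by (intro borel_measurable_times borel_measurable_diff borel_measurable_const qm true_prob'
          measurable_compose[OF y']) auto
    have Zm': "Z \<in> borel_measurable \<mu>" using Zm by (rule past_measurable_imp)
    have "D i y * D j y = Z (shift_by (int j) y) * (of_bool (shift_by (int j) y 0) - true_prob (shift_by (int j) y))" for y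
      by (simp add: Z_def D_def[of j] shift_by_shift_by)
    then have "expectation (\<lambda>y. D i y * D j y)
        = expectation (\<lambda>y. Z (shift_by (int j) y) * (of_bool (shift_by (int j) y 0) - true_prob (shift_by (int j) y)))"
      by simp
    also have "\<dots> = expectation (\<lambda>y. Z y * (of_bool (y 0) - true_prob y))"
      by (intro integral_shift_by borel_measurable_times borel_measurable_diff Zm' true_prob_measurable
          measurable_compose[OF coord_measurable]) auto
    also have "\<dots> = expectation (\<lambda>y. Z y * of_bool (y 0)) - expectation (\<lambda>y. Z y * true_prob y)"
    proof -
      have "integrable \<mu> (\<lambda>y. Z y * of_bool (y 0))" "integrable \<mu> (\<lambda>y. Z y * true_prob y)"
      proof -
        have "\<bar>Z y * of_bool (y 0)\<bar> \<le> 1" "\<bar>Z y * true_prob y\<bar> \<le> 1" for y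
          unfolding abs_mult using Zbnd[of y] true_prob_range[of y] by (auto intro!: mult_le_one)
        then show "integrable \<mu> (\<lambda>y. Z y * of_bool (y 0))" "integrable \<mu> (\<lambda>y. Z y * true_prob y)"
          using Zm' by (auto intro!: integrable_const_bound[where B=1])
      qed
      then show ?thesis by (simp add: right_diff_distrib)
    qed
    also have "\<dots> = 0" using integral_true_prob[OF Zm Zbnd] by simp
    finally show "expectation (\<lambda>y. D i y * D j y) = 0" .
  qed (auto simp: D_bnd)
  then show ?thesis unfolding D_eq .
qed

end


section \<open>Error rates of the scheme and of the experts\<close>

lemma ctx_shift_by: "ctx k (shift_by (int n) y) = map y [int n - int k..int n - 1]"
  by (rule nth_equalityI) (auto simp: ctx_def nth_upto algebra_simps)

definition occurrences :: "nat \<Rightarrow> bool list \<Rightarrow> bool \<Rightarrow> (int \<Rightarrow> bool) \<Rightarrow> nat set" where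
  "occurrences n s b y = {i. length s < i \<and> i < n \<and> ctx (length s) (shift_by (int i) y) = s \<and> y (int i) = b}"

text \<open>
  While \<open>n \<le> k + 1\<close> both counts are 0, which matches the default prediction 1.
\<close>

lemma markov_expert_iff_majority:
  assumes s: "s = ctx k (shift_by (int n) y)"
  shows "markov_expert k n (past y n) \<longleftrightarrow> card (occurrences n s False y) \<le> card (occurrences n s True y)"
proof (cases "n \<le> k + 1")
  case True
  then have "occurrences n s b y = {}" for b by (auto simp: occurrences_def s)
  then show ?thesis using True by (simp add: markov_expert_def markov_est_def)
next
  case False
  let ?ys = "past y n"
  have sub: "substr ?ys (i - k) (i - 1) = ctx k (shift_by (int i) y)" if "k < i" "i \<le> n" for i
    using that by (subst map_substr) (auto simp: ctx_shift_by of_nat_diff)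
  have ctx_n: "substr ?ys (n - k) (n - 1) = s" using False sub[of n] by (simp add: s)
  have num: "{i. k < i \<and> i < n \<and> substr ?ys (i - k) (i - 1) = s \<and> ?ys ! (i - 1) = b} = occurrences n s b y" for b
    unfolding occurrences_def using sub by (auto simp: s nth_past)
  have fin: "finite (occurrences n s b y)" for b
    by (rule finite_subset[of _ "{..<n}"]) (auto simp: occurrences_def)
  have den: "{i. k < i \<and> i < n \<and> substr ?ys (i - k) (i - 1) = s}
      = occurrences n s False y \<union> occurrences n s True y"
    unfolding occurrences_def using sub by (auto simp: s)
  have card_den: "card (occurrences n s False y \<union> occurrences n s True y)
      = card (occurrences n s False y) + card (occurrences n s True y)"
    by (rule card_Un_disjoint) (auto simp: fin, auto simp: occurrences_def)
  have "markov_est k n False ?ys s > 1 / 2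
      \<longleftrightarrow> card (occurrences n s False y) > card (occurrences n s True y)"
    using False unfolding markov_est_def num den card_den Let_def
    by (auto simp: divide_simps)
  then show ?thesis unfolding markov_expert_def ctx_n by (simp add: not_less)
qed

lemma average_le_if_eventually_le:
  fixes a b :: "nat \<Rightarrow> real"
  assumes le: "\<forall>\<^sub>F i in sequentially. a i \<le> b i" and bnd: "\<And>i. a i - b i \<le> 1" and e: "e > 0"
  shows "\<forall>\<^sub>F n in sequentially. (\<Sum>i = 1..n. a i) / n \<le> (\<Sum>i = 1..n. b i) / n + e"
proof -
  obtain N where N: "\<And>i. i \<ge> N \<Longrightarrow> a i \<le> b i"
    using le unfolding eventually_sequentially by blast
  have diff: "(\<Sum>i = 1..n. a i) - (\<Sum>i = 1..n. b i) \<le> N" for n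
  proof -
    have "(\<Sum>i = 1..n. a i - b i) \<le> (\<Sum>i = 1..n. if i < N then 1 else 0)"
      using N bnd by (intro sum_mono) (auto simp: not_less)
    also have "\<dots> = real (card ({1..n} \<inter> {i. i < N}))" by (simp add: sum.If_cases)
    also have "card ({1..n} \<inter> {i. i < N}) \<le> card {..<N}" by (intro card_mono) auto
    finally show ?thesis by (simp add: sum_subtractf)
  qed
  have "(\<lambda>n. real N / real n) \<longlonglongrightarrow> 0" by real_asymp
  from order_tendstoD(2)[OF this e] show ?thesis
  proof eventually_elim
    case (elim n)
    have "((\<Sum>i = 1..n. a i) - (\<Sum>i = 1..n. b i)) / n \<le> N / n" by (intro divide_right_mono diff) simp
    then show ?case using elim by (simp add: diff_divide_distrib)
  qed
qed

lemma finite_contexts: "finite {s :: bool list. length s = k}"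
  using finite_lists_length_eq[of "UNIV :: bool set" k] by simp

context ergodic_path
begin

definition bayes_loss :: real where
  "bayes_loss = (\<integral>y. min (true_prob y) (1 - true_prob y) \<partial>\<mu>)"

lemma integrable_bounded:
  fixes f :: "(int \<Rightarrow> bool) \<Rightarrow> real"
  shows "f \<in> borel_measurable \<mu> \<Longrightarrow> (\<And>y. \<bar>f y\<bar> \<le> C) \<Longrightarrow> integrable \<mu> f"
  by (rule integrable_const_bound[where B=C]) auto

text \<open>
  Whatever the prediction, its conditional error is a convex combination of \<open>t\<close> and \<open>1 - t\<close>, where
  \<open>t\<close> is the value of \<open>true_prob\<close>.
\<close>

lemma liminf_mean_err:
  "AE y in \<mu>. \<forall>e>0. \<forall>\<^sub>F n in sequentially. (\<Sum>i = 1..n. mean_err y i) / n \<ge> bayes_loss - e"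
proof -
  have "AE y in \<mu>. (\<lambda>n. (\<Sum>i = 1..n. min (true_prob (shift_by (int i) y)) (1 - true_prob (shift_by (int i) y))) / n) \<longlonglongrightarrow> bayes_loss"
    unfolding bayes_loss_def
    by (rule birkhoff_path[where C=1 and f="\<lambda>y. min (true_prob y) (1 - true_prob y)"])
       (use true_prob_range in \<open>auto simp: abs_le_iff min_def\<close>)
  moreover have "AE y in \<mu>. (\<lambda>n. (\<Sum>i = 1..n. mean_err y i - cond_err mean_pred i y) / n) \<longlonglongrightarrow> 0"
    unfolding mean_err_def by (rule err_minus_cond_err_vanishes) (simp add: mean_pred_range)
  ultimately show ?thesis
  proof eventually_elim
    case (elim y)
    show ?case
    proof (intro allI impI)
      fix e :: real assume "e > 0"
      have "\<forall>\<^sub>F n in sequentially. bayes_loss - e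
          < (\<Sum>i = 1..n. min (true_prob (shift_by (int i) y)) (1 - true_prob (shift_by (int i) y))) / n
          + (\<Sum>i = 1..n. mean_err y i - cond_err mean_pred i y) / n"
        using tendsto_add[OF elim] by (rule order_tendstoD) (use \<open>e > 0\<close> in simp)
      then show "\<forall>\<^sub>F n in sequentially. (\<Sum>i = 1..n. mean_err y i) / n \<ge> bayes_loss - e"
      proof eventually_elim
        case (elim n)
        have "min (true_prob (shift_by (int i) y)) (1 - true_prob (shift_by (int i) y)) \<le> cond_err mean_pred i y" for i
        proof -
          define q t where "q = mean_pred i (past y i)" and "t = true_prob (shift_by (int i) y)"
          have "cond_err mean_pred i y = q * (1 - t) + (1 - q) * t"
            by (simp add: cond_err_def q_def t_def algebra_simps)
          also have "\<dots> \<ge> q * min t (1 - t) + (1 - q) * min t (1 - t)"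
            using mean_pred_range[of i "past y i"] by (intro add_mono mult_left_mono) (auto simp: q_def)
          finally show ?thesis by (simp add: t_def algebra_simps)
        qed
        then have "(\<Sum>i = 1..n. min (true_prob (shift_by (int i) y)) (1 - true_prob (shift_by (int i) y))) / n
            \<le> (\<Sum>i = 1..n. cond_err mean_pred i y) / n"
          by (intro divide_right_mono sum_mono) auto
        then show ?case using elim by (simp add: sum_subtractf diff_divide_distrib)
      qed
    qed
  qed
qed

definition mass :: "bool list \<Rightarrow> bool \<Rightarrow> real" where
  "mass s b = prob {y. ctx (length s) y = s \<and> y 0 = b}"

text \<open>
  The conditional error of the best prediction from the last \<open>k\<close> symbols; in a tied context, where the
  empirical majority may favour either symbol for ever, the larger of the two possible errors.
\<close>

definition plugin_bound :: "nat \<Rightarrow> (int \<Rightarrow> bool) \<Rightarrow> real" where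
  "plugin_bound k y =
     (let s = ctx k y in
      if mass s False < mass s True then 1 - true_prob y
      else if mass s True < mass s False then true_prob y
      else max (true_prob y) (1 - true_prob y))"

lemma ctx_measurable'[measurable]: "ctx k \<in> \<mu> \<rightarrow>\<^sub>M count_space UNIV"
  by (rule past_measurable_imp[OF ctx_measurable])

lemma cylinder_sets[measurable]: "{y. ctx k y = s \<and> y 0 = b} \<in> sets \<mu>"
proof -
  have "{y \<in> space \<mu>. ctx k y = s \<and> y 0 = b} \<in> sets \<mu>" by measurable
  then show ?thesis by simp
qed

lemma occurrence_frequency:
  "AE y in \<mu>. (\<lambda>n. card (occurrences n s b y) / n) \<longlonglongrightarrow> mass s b"
proof -
  define f where "f = (indicat_real {y. ctx (length s) y = s \<and> y 0 = b})"
  have "AE y in \<mu>. (\<lambda>n. (\<Sum>i = 1..n. f (shift_by (int i) y)) / n) \<longlonglongrightarrow> (\<integral>y. f y \<partial>\<mu>)"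
    by (rule birkhoff_path[where C=1]) (auto simp: f_def indicator_def)
  then show ?thesis
  proof eventually_elim
    case (elim y)
    let ?k = "length s"
    have count: "card (occurrences n s b y) = (\<Sum>i\<in>{?k<..<n}. f (shift_by (int i) y))" for n
    proof -
      have "occurrences n s b y = {?k<..<n} \<inter> {i. ctx ?k (shift_by (int i) y) = s \<and> shift_by (int i) y 0 = b}"
        by (auto simp: occurrences_def)
      moreover have "(\<Sum>i\<in>{?k<..<n}. f (shift_by (int i) y))
          = (\<Sum>i\<in>{?k<..<n}. if ctx ?k (shift_by (int i) y) = s \<and> shift_by (int i) y 0 = b then 1 else 0)"
        by (intro sum.cong) (auto simp: f_def indicator_def)
      ultimately show ?thesis by (simp add: sum.If_cases)
    qed
    have "(\<lambda>n. (\<Sum>i = 1..n. f (shift_by (int i) y)) / n - card (occurrences n s b y) / n) \<longlonglongrightarrow> 0"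
    proof (rule Lim_null_comparison)
      show "\<forall>\<^sub>F n in sequentially.
          norm ((\<Sum>i = 1..n. f (shift_by (int i) y)) / n - card (occurrences n s b y) / n) \<le> real (?k + 1) / real n"
      proof (intro always_eventually allI)
        fix n
        have "(\<Sum>i = 1..n. f (shift_by (int i) y)) = (\<Sum>i\<in>{?k<..<n}. f (shift_by (int i) y))
            + (\<Sum>i\<in>{1..n} - {?k<..<n}. f (shift_by (int i) y))"
          by (subst sum.subset_diff[of "{?k<..<n}"]) auto
        moreover have "(\<Sum>i\<in>{1..n} - {?k<..<n}. f (shift_by (int i) y)) \<le> (\<Sum>i\<in>{1..n} - {?k<..<n}. 1)"
          by (intro sum_mono) (auto simp: f_def indicator_def)
        moreover have "card ({1..n} - {?k<..<n}) \<le> card (insert n {1..?k})"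
          by (intro card_mono) auto
        moreover have "card (insert n {1..?k}) \<le> ?k + 1" by (simp add: card_insert_if)
        moreover have "0 \<le> (\<Sum>i\<in>{1..n} - {?k<..<n}. f (shift_by (int i) y))"
          by (intro sum_nonneg) (auto simp: f_def)
        ultimately have "\<bar>(\<Sum>i = 1..n. f (shift_by (int i) y)) - card (occurrences n s b y)\<bar> \<le> ?k + 1"
          unfolding count by simp
        then show "norm ((\<Sum>i = 1..n. f (shift_by (int i) y)) / n - card (occurrences n s b y) / n) \<le> real (?k + 1) / real n"
          by (simp add: diff_divide_distrib[symmetric] divide_right_mono)
      qed
      show "(\<lambda>n. real (?k + 1) / real n) \<longlonglongrightarrow> 0" by real_asymp
    qed
    from tendsto_diff[OF elim this] show ?case by (simp add: f_def mass_def)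
  qed
qed

text \<open>
  There are only finitely many contexts of length \<open>k\<close>, so from some time on the empirical majority
  is right in all contexts that are not tied.
\<close>

lemma eventually_expert_cond_err_le:
  "AE y in \<mu>. \<forall>\<^sub>F n in sequentially.
     cond_err (\<lambda>n l. of_bool (markov_expert k n l)) n y \<le> plugin_bound k (shift_by (int n) y)"
proof -
  have "AE y in \<mu>. \<forall>s\<in>{s. length s = k}. \<forall>b. (\<lambda>n. card (occurrences n s b y) / n) \<longlonglongrightarrow> mass s b"
    by (intro AE_finite_allI[OF finite_contexts]) (simp add: AE_all_countable occurrence_frequency)
  then show ?thesis
  proof eventually_elim
    case (elim y)
    have majority: "\<forall>\<^sub>F n in sequentially. card (occurrences n s b y) < card (occurrences n s b' y)"
      if "length s = k" "mass s b < mass s b'" for s b b'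
    proof -
      have "\<forall>\<^sub>F n in sequentially.
          0 < real (card (occurrences n s b' y)) / n - card (occurrences n s b y) / n"
        using elim that by (intro order_tendstoD(1)[OF tendsto_diff]) auto
      then show ?thesis
      proof eventually_elim
        case (elim n)
        then have "real (card (occurrences n s b y)) < card (occurrences n s b' y)"
          by (simp add: diff_divide_distrib[symmetric] zero_less_divide_iff)
        then show ?case by simp
      qed
    qed
    have "\<forall>\<^sub>F n in sequentially. \<forall>s\<in>{s. length s = k}. \<forall>b b'. mass s b < mass s b' \<longrightarrow>
        card (occurrences n s b y) < card (occurrences n s b' y)"
      using finite_contexts majority
      by (intro eventually_ball_finite ballI eventually_all_finite) (auto intro: eventually_mono)
    then show ?case
    proof eventually_elim
      case (elim n)
      define s where "s = ctx k (shift_by (int n) y)"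
      have maj: "mass s b < mass s b' \<Longrightarrow> card (occurrences n s b y) < card (occurrences n s b' y)" for b b'
        using elim by (simp add: s_def)
      show ?case
        using maj[of True False] maj[of False True] markov_expert_iff_majority[OF s_def]
        by (auto simp: cond_err_def plugin_bound_def Let_def s_def[symmetric])
    qed
  qed
qed

lemma plugin_bound_range: "0 \<le> plugin_bound k y" "plugin_bound k y \<le> 1"
  using true_prob_range[of y] by (auto simp: plugin_bound_def Let_def)

lemma plugin_bound_measurable[measurable]: "plugin_bound k \<in> borel_measurable \<mu>"
proof -
  have "(\<lambda>y. (if mass (ctx k y) False < mass (ctx k y) True then 1 - true_prob y
      else if mass (ctx k y) True < mass (ctx k y) False then true_prob y
      else max (true_prob y) (1 - true_prob y))) \<in> borel_measurable \<mu>"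
    by measurable
  then show ?thesis by (simp add: plugin_bound_def[abs_def] Let_def)
qed

abbreviation on_ctx :: "bool list \<Rightarrow> (int \<Rightarrow> bool) \<Rightarrow> real" where
  "on_ctx s y \<equiv> of_bool (ctx (length s) y = s)"

lemma on_ctx_past_measurable: "on_ctx s \<in> borel_measurable path_past"
  by (rule measurable_compose[OF ctx_measurable, of "\<lambda>l. of_bool (l = s)"]) simp

lemma on_ctx_measurable[measurable]: "on_ctx s \<in> borel_measurable \<mu>"
  by (rule past_measurable_imp[OF on_ctx_past_measurable])

lemma integrable_on_ctx:
  "f \<in> borel_measurable \<mu> \<Longrightarrow> (\<And>y. 0 \<le> f y \<and> f y \<le> 1) \<Longrightarrow> integrable \<mu> (\<lambda>y. on_ctx s y * f y)"
  by (rule integrable_bounded[where C=1]) (auto simp: of_bool_def)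

lemma sum_on_ctx:
  assumes f: "f \<in> borel_measurable \<mu>" and bnd: "\<And>y. 0 \<le> f y \<and> f y \<le> 1"
  shows "(\<integral>y. f y \<partial>\<mu>) = (\<Sum>s | length s = k. \<integral>y. on_ctx s y * f y \<partial>\<mu>)"
proof -
  have "f y = (\<Sum>s | length s = k. on_ctx s y * f y)" for y
  proof -
    have "(\<Sum>s | length s = k. on_ctx s y * f y) = (\<Sum>s | length s = k. if s = ctx k y then f y else 0)"
      by (intro sum.cong) auto
    then show ?thesis using finite_contexts by simp
  qed
  then have "(\<integral>y. f y \<partial>\<mu>) = (\<integral>y. (\<Sum>s | length s = k. on_ctx s y * f y) \<partial>\<mu>)" by presburger
  also have "\<dots> = (\<Sum>s | length s = k. \<integral>y. on_ctx s y * f y \<partial>\<mu>)"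
    by (intro Bochner_Integration.integral_sum integrable_on_ctx f bnd)
  finally show ?thesis .
qed

lemma mass_True: "mass s True = (\<integral>y. on_ctx s y * true_prob y \<partial>\<mu>)"
proof -
  have "(\<integral>y. on_ctx s y * true_prob y \<partial>\<mu>) = (\<integral>y. on_ctx s y * of_bool (y 0) \<partial>\<mu>)"
    by (rule integral_true_prob[where C=1, symmetric]) (auto simp: on_ctx_past_measurable)
  also have "\<dots> = (\<integral>y. indicat_real {y. ctx (length s) y = s \<and> y 0 = True} y \<partial>\<mu>)"
    by (intro Bochner_Integration.integral_cong) (auto simp: indicator_def)
  also have "\<dots> = mass s True" by (simp add: mass_def)
  finally show ?thesis ..
qed

lemma mass_False: "mass s False = (\<integral>y. on_ctx s y * (1 - true_prob y) \<partial>\<mu>)"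
proof -
  have "mass s True + mass s False = prob ({y. ctx (length s) y = s \<and> y 0 = True} \<union> {y. ctx (length s) y = s \<and> y 0 = False})"
    unfolding mass_def by (rule finite_measure_Union[symmetric]) (rule cylinder_sets, rule cylinder_sets, auto)
  also have "\<dots> = (\<integral>y. indicat_real ({y. ctx (length s) y = s \<and> y 0 = True} \<union> {y. ctx (length s) y = s \<and> y 0 = False}) y \<partial>\<mu>)"
    by simp
  also have "\<dots> = (\<integral>y. on_ctx s y \<partial>\<mu>)"
    by (intro Bochner_Integration.integral_cong) (auto simp: indicator_def)
  finally have "mass s False = (\<integral>y. on_ctx s y \<partial>\<mu>) - (\<integral>y. on_ctx s y * true_prob y \<partial>\<mu>)"
    by (simp add: mass_True)
  also have "\<dots> = (\<integral>y. on_ctx s y * (1 - true_prob y) \<partial>\<mu>)"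
    using integrable_on_ctx[of "\<lambda>_. 1" s] integrable_on_ctx[of true_prob s] true_prob_range
    by (simp add: right_diff_distrib)
  finally show ?thesis .
qed

text \<open>
  The error probability of the best prediction from the last \<open>k\<close> symbols.
\<close>

definition markov_loss :: "nat \<Rightarrow> real" where
  "markov_loss k = (\<Sum>s | length s = k. min (mass s True) (mass s False))"

text \<open>
  Let \<open>t\<close> be \<open>true_prob\<close>.  In a context \<open>s\<close> without a tie the integral of \<open>plugin_bound\<close> is the smaller mass, and the integral
  of \<open>min t (1 - t)\<close> is no larger.  In a tied context \<open>max t (1 - t) = 1 - min t (1 - t)\<close>, and the
  total mass of the context is twice the smaller mass.  Both cases obey the same bound, which is
  then summed over the contexts.
\<close>

lemma integral_plugin_bound_le: "(\<integral>y. plugin_bound k y \<partial>\<mu>) \<le> 2 * markov_loss k - bayes_loss"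
proof -
  let ?m = "\<lambda>y. min (true_prob y) (1 - true_prob y)"
  have mr: "0 \<le> ?m y \<and> ?m y \<le> 1" for y using true_prob_range[of y] by auto
  have cr: "0 \<le> true_prob y \<and> true_prob y \<le> 1" "0 \<le> 1 - true_prob y \<and> 1 - true_prob y \<le> 1" for y using true_prob_range[of y] by auto
  have ctxwise: "(\<integral>y. on_ctx s y * plugin_bound k y \<partial>\<mu>)
      \<le> 2 * min (mass s True) (mass s False) - (\<integral>y. on_ctx s y * ?m y \<partial>\<mu>)" if s: "length s = k" for s
  proof -
    have mT: "(\<integral>y. on_ctx s y * ?m y \<partial>\<mu>) \<le> mass s True"
      unfolding mass_True using mr cr by (intro integral_mono integrable_on_ctx mult_left_mono) auto
    have mF: "(\<integral>y. on_ctx s y * ?m y \<partial>\<mu>) \<le> mass s False"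
      unfolding mass_False using mr cr by (intro integral_mono integrable_on_ctx mult_left_mono) auto
    consider "mass s False < mass s True" | "mass s True < mass s False" | "mass s True = mass s False"
      by linarith
    then show ?thesis
    proof cases
      case 1
      then have "(\<integral>y. on_ctx s y * plugin_bound k y \<partial>\<mu>) = (\<integral>y. on_ctx s y * (1 - true_prob y) \<partial>\<mu>)"
        by (intro Bochner_Integration.integral_cong) (auto simp: plugin_bound_def Let_def s)
      also have "\<dots> = mass s False" by (simp add: mass_False)
      finally show ?thesis using 1 mF by simp
    next
      case 2
      then have "(\<integral>y. on_ctx s y * plugin_bound k y \<partial>\<mu>) = (\<integral>y. on_ctx s y * (true_prob y) \<partial>\<mu>)"
        by (intro Bochner_Integration.integral_cong) (auto simp: plugin_bound_def Let_def s)
      also have "\<dots> = mass s True" by (simp add: mass_True)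
      finally show ?thesis using 2 mT by simp
    next
      case 3
      have "(\<integral>y. on_ctx s y * plugin_bound k y \<partial>\<mu>)
          = (\<integral>y. on_ctx s y * true_prob y + on_ctx s y * (1 - true_prob y) - on_ctx s y * ?m y \<partial>\<mu>)"
        using 3 by (intro Bochner_Integration.integral_cong) (auto simp: plugin_bound_def Let_def s)
      also have "\<dots> = mass s True + mass s False - (\<integral>y. on_ctx s y * ?m y \<partial>\<mu>)"
        unfolding mass_True mass_False using mr cr
        by (subst Bochner_Integration.integral_diff Bochner_Integration.integral_add;
            (intro Bochner_Integration.integrable_add integrable_on_ctx)?; simp)+
      finally show ?thesis using 3 by simp
    qed
  qed
  have "(\<integral>y. plugin_bound k y \<partial>\<mu>) = (\<Sum>s | length s = k. \<integral>y. on_ctx s y * plugin_bound k y \<partial>\<mu>)"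
    by (intro sum_on_ctx) (auto simp: plugin_bound_range)
  also have "\<dots> \<le> (\<Sum>s | length s = k. 2 * min (mass s True) (mass s False) - (\<integral>y. on_ctx s y * ?m y \<partial>\<mu>))"
    by (intro sum_mono ctxwise) simp
  also have "\<dots> = 2 * markov_loss k - bayes_loss"
    using sum_on_ctx[of ?m k] mr
    by (simp add: sum_subtractf markov_loss_def sum_distrib_left bayes_loss_def)
  finally show ?thesis .
qed

text \<open>
  Predicting 1 exactly on the event \<open>A\<close> that \<open>true_prob > 1 / 2\<close> is optimal given the whole past.  If \<open>C\<close>
  depends on \<open>k\<close> past symbols only and differs from \<open>A\<close> with small probability, predicting 1 exactly
  on \<open>C\<close> is nearly as good, and it competes in the minimum that defines \<open>markov_loss k\<close>.
\<close>

lemma markov_loss_close: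
  assumes e: "e > 0"
  obtains k where "k \<ge> 1" "markov_loss k \<le> bayes_loss + e"
proof -
  define A where "A = {y. true_prob y > 1 / 2}"
  have A_past: "A \<in> sets path_past"
  proof -
    have "{y \<in> space path_past. true_prob y > 1 / 2} \<in> sets path_past" by measurable
    then show ?thesis by (simp add: A_def)
  qed
  have [measurable]: "A \<in> sets \<mu>" using A_past path_past_subalgebra by (auto simp: subalgebra_def)
  have window_measurable: "window_sets \<subseteq> sets \<mu>"
  proof
    fix C assume "C \<in> window_sets"
    then obtain k S where "C = {y. ctx k y \<in> S}" by (rule window_setE)
    moreover have "ctx k -` S \<inter> space \<mu> \<in> sets \<mu>" by measurable
    ultimately show "C \<in> sets \<mu>" by (simp add: vimage_def)
  qed
  obtain C where C: "C \<in> window_sets" "prob ((A - C) \<union> (C - A)) < e"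
    using algebra_approximates_sigma_algebra[of window_sets A e] algebra_window_sets window_measurable
      A_past path_past_subset_window e by auto
  note [measurable] = subsetD[OF window_measurable C(1)]
  obtain k S where k: "k \<ge> 1" "C = {y. ctx k y \<in> S}" using C(1) by (rule window_setE)
  have cr: "0 \<le> true_prob y" "true_prob y \<le> 1" for y by (rule true_prob_range)+
  define f where "f y = (if y \<in> C then 1 - true_prob y else true_prob y)" for y
  have [measurable]: "f \<in> borel_measurable \<mu>" unfolding f_def[abs_def] by measurable
  have f_range: "0 \<le> f y \<and> f y \<le> 1" for y using cr[of y] by (auto simp: f_def)
  have "markov_loss k \<le> (\<Sum>s | length s = k. \<integral>y. on_ctx s y * f y \<partial>\<mu>)"
    unfolding markov_loss_def
  proof (intro sum_mono)
    fix s assume "s \<in> {s :: bool list. length s = k}"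
    then have s: "length s = k" by simp
    have "(\<integral>y. on_ctx s y * f y \<partial>\<mu>) = (if s \<in> S then mass s False else mass s True)"
      unfolding mass_True mass_False if_distrib[symmetric]
      by (cases "s \<in> S") (auto intro!: Bochner_Integration.integral_cong simp: f_def k s)
    then show "min (mass s True) (mass s False) \<le> (\<integral>y. on_ctx s y * f y \<partial>\<mu>)" by simp
  qed
  also have "\<dots> = (\<integral>y. f y \<partial>\<mu>)" by (rule sum_on_ctx[symmetric]) (auto simp: f_range)
  also have "\<dots> \<le> (\<integral>y. min (true_prob y) (1 - true_prob y) + indicat_real ((A - C) \<union> (C - A)) y \<partial>\<mu>)"
  proof (rule integral_mono)
    show "integrable \<mu> f" by (rule integrable_bounded[where C=1]) (use f_range in \<open>auto simp: abs_le_iff\<close>)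
    show "integrable \<mu> (\<lambda>y. min (true_prob y) (1 - true_prob y) + indicat_real ((A - C) \<union> (C - A)) y)"
      by (rule integrable_bounded[where C=2])
         (use cr in \<open>auto simp: abs_le_iff indicator_def min_def\<close>)
    show "f y \<le> min (true_prob y) (1 - true_prob y) + indicat_real ((A - C) \<union> (C - A)) y" for y
      using cr[of y] by (auto simp: f_def A_def indicator_def)
  qed
  also have "\<dots> = bayes_loss + prob ((A - C) \<union> (C - A))"
  proof -
    have "integrable \<mu> (\<lambda>y. min (true_prob y) (1 - true_prob y))"
      by (rule integrable_bounded[where C=1]) (use cr in \<open>auto simp: abs_le_iff min_def\<close>)
    moreover have "integrable \<mu> (indicat_real ((A - C) \<union> (C - A)))"
      by (rule integrable_bounded[where C=1]) (auto simp: indicator_def)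
    ultimately show ?thesis by (subst Bochner_Integration.integral_add) (auto simp: bayes_loss_def)
  qed
  finally show ?thesis using C(2) by (intro that[OF k(1)]) simp
qed

lemma limsup_expert_err:
  assumes e: "e > 0"
  obtains k where "k \<ge> 1"
    "AE y in \<mu>. \<forall>\<^sub>F n in sequentially. (\<Sum>i = 1..n. expert_err k y i) / n \<le> bayes_loss + e"
proof -
  \<comment> \<open>The excess of \<open>markov_loss k\<close> counts twice in \<open>integral_plugin_bound_le\<close>.\<close>
  obtain k where k: "k \<ge> 1" "markov_loss k \<le> bayes_loss + e / 8"
    using markov_loss_close[of "e / 8"] e by auto
  define q where "q n l = (of_bool (markov_expert k n l) :: real)" for n l
  have q: "0 \<le> q n l \<and> q n l \<le> 1" for n l by (simp add: q_def)
  have E: "(\<integral>y. plugin_bound k y \<partial>\<mu>) < bayes_loss + e / 2"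
    using integral_plugin_bound_le[of k] k(2) e by linarith
  have err: "expert_err k y i = \<bar>q i (past y i) - of_bool (y (int i))\<bar>" for y i
    by (auto simp: expert_err_def q_def)
  have "AE y in \<mu>. (\<lambda>n. (\<Sum>i = 1..n. plugin_bound k (shift_by (int i) y)) / n) \<longlonglongrightarrow> (\<integral>y. plugin_bound k y \<partial>\<mu>)"
    by (rule birkhoff_path[where C=1]) (use plugin_bound_range in \<open>auto simp: abs_le_iff intro: order_trans[of _ 0]\<close>)
  moreover have "AE y in \<mu>. (\<lambda>n. (\<Sum>i = 1..n. expert_err k y i - cond_err q i y) / n) \<longlonglongrightarrow> 0"
    unfolding err by (rule err_minus_cond_err_vanishes[OF q])
  moreover have "AE y in \<mu>. \<forall>\<^sub>F n in sequentially. cond_err q n y \<le> plugin_bound k (shift_by (int n) y)"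
    using eventually_expert_cond_err_le[of k] by (simp add: q_def[abs_def])
  ultimately have "AE y in \<mu>. \<forall>\<^sub>F n in sequentially. (\<Sum>i = 1..n. expert_err k y i) / n \<le> bayes_loss + e"
  proof eventually_elim
    case (elim y)
    have "cond_err q i y \<le> 1" for i
      using true_prob_range[of "shift_by (int i) y"] by (auto simp: cond_err_def q_def)
    then have "cond_err q i y - plugin_bound k (shift_by (int i) y) \<le> 1" for i
      using plugin_bound_range(1)[of k "shift_by (int i) y"] by (smt (verit))
    from average_le_if_eventually_le[OF elim(3) this, of "e / 4"]
    have "\<forall>\<^sub>F n in sequentially. (\<Sum>i = 1..n. cond_err q i y) / n
        \<le> (\<Sum>i = 1..n. plugin_bound k (shift_by (int i) y)) / n + e / 4" using e by simp
    moreover have "\<forall>\<^sub>F n in sequentially. (\<Sum>i = 1..n. plugin_bound k (shift_by (int i) y)) / n < bayes_loss + e / 2"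
      using elim(1) E by (rule order_tendstoD)
    moreover have "\<forall>\<^sub>F n in sequentially. (\<Sum>i = 1..n. expert_err k y i - cond_err q i y) / n < e / 4"
      using elim(2) by (rule order_tendstoD) (use e in simp)
    ultimately show ?case
    proof eventually_elim
      case (elim n)
      then show ?case unfolding sum_subtractf diff_divide_distrib by linarith
    qed
  qed
  then show ?thesis by (rule that[OF k(1)])
qed

proposition mean_err_converges:
  "AE y in \<mu>. (\<lambda>n. (\<Sum>i = 1..n. mean_err y i) / n) \<longlonglongrightarrow> bayes_loss"
proof -
  have "AE y in \<mu>. \<forall>\<^sub>F n in sequentially. (\<Sum>i = 1..n. mean_err y i) / n \<le> bayes_loss + 1 / Suc j" for j
  proof -
    obtain k where k: "k \<ge> 1"
        "AE y in \<mu>. \<forall>\<^sub>F n in sequentially. (\<Sum>i = 1..n. expert_err k y i) / n \<le> bayes_loss + 1 / Suc j / 2"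
      by (rule limsup_expert_err[of "1 / Suc j / 2"]) (simp del: of_nat_Suc, blast)
    from k(2) show ?thesis
    proof eventually_elim
      case (elim y)
      have "\<forall>\<^sub>F n in sequentially. (\<Sum>i = 1..n. mean_err y i) / n \<le> (\<Sum>i = 1..n. expert_err k y i) / n + 1 / Suc j / 2"
        by (rule scheme_tracks_expert[OF k(1)]) (simp del: of_nat_Suc)
      with elim show ?case
      proof eventually_elim
        case (elim n)
        moreover have "1 / real (Suc j) / 2 + 1 / real (Suc j) / 2 = 1 / real (Suc j)" by (rule field_sum_of_halves)
        ultimately show ?case by linarith
      qed
    qed
  qed
  then have "AE y in \<mu>. \<forall>j. \<forall>\<^sub>F n in sequentially. (\<Sum>i = 1..n. mean_err y i) / n \<le> bayes_loss + 1 / Suc j"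
    by (simp only: AE_all_countable) simp
  with liminf_mean_err show ?thesis
  proof eventually_elim
    case (elim y)
    show ?case
    proof (rule tendstoI)
      fix e :: real assume e: "e > 0"
      obtain j where j: "1 / real (Suc j) < e" using nat_approx_posE[OF e] by metis
      have "\<forall>\<^sub>F n in sequentially. (\<Sum>i = 1..n. mean_err y i) / n \<ge> bayes_loss - e / 2"
        using elim(1) e by simp
      moreover have "\<forall>\<^sub>F n in sequentially. (\<Sum>i = 1..n. mean_err y i) / n \<le> bayes_loss + 1 / Suc j"
        using elim(2) by blast
      ultimately show "\<forall>\<^sub>F n in sequentially. dist ((\<Sum>i = 1..n. mean_err y i) / n) bayes_loss < e"
      proof eventually_elim
        case (elim n)
        then show ?case using j e unfolding dist_real_def abs_less_iff by linarith
      qed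
    qed
  qed
qed

end


section \<open>Randomization\<close>

text \<open>
  The error indicator of the threshold rule at \<open>q\<close>, minus its mean for uniform \<open>u\<close>.
\<close>

definition threshold_noise :: "real \<Rightarrow> bool \<Rightarrow> real \<Rightarrow> real" where
  "threshold_noise q b u = of_bool ((u \<le> q) \<noteq> b) - \<bar>q - of_bool b\<bar>"

lemma threshold_noise_measurable[measurable]: "threshold_noise q b \<in> borel_measurable borel"
proof -
  have "threshold_noise q b = (\<lambda>u. (if b then (if u \<le> q then 0 else 1) else (if u \<le> q then 1 else 0)) - \<bar>q - of_bool b\<bar>)"
    by (auto simp: threshold_noise_def fun_eq_iff)
  also have "\<dots> \<in> borel_measurable borel" by (cases b) simp_all
  finally show ?thesis .
qed

lemma threshold_noise_bound: "0 \<le> q \<Longrightarrow> q \<le> 1 \<Longrightarrow> \<bar>threshold_noise q b u\<bar> \<le> 1"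
  by (cases b) (auto simp: threshold_noise_def of_bool_def)

context prob_space
begin

lemma threshold_noise_centered:
  assumes V[measurable]: "random_variable borel V"
    and unif: "distr M borel V = uniform_measure lborel {0..1}" and q: "0 \<le> q" "q \<le> 1"
  shows "expectation (\<lambda>\<omega>. threshold_noise q b (V \<omega>)) = 0"
proof -
  have "prob {\<omega> \<in> space M. V \<omega> \<le> q} = measure (distr M borel V) {..q}"
    by (subst measure_distr) (auto simp: vimage_def Int_def conj_commute)
  also have "\<dots> = measure lborel ({0..1} \<inter> {..q}) / measure lborel {0..1::real}"
    unfolding unif by (rule measure_uniform_measure) auto
  also have "{0..1} \<inter> {..q} = {0..q}" using q by auto
  finally have P: "prob {\<omega> \<in> space M. V \<omega> \<le> q} = q" using q by simp
  let ?I = "indicat_real {\<omega> \<in> space M. V \<omega> \<le> q}"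
  have I: "integrable M ?I" by (rule integrable_const_bound[where B=1]) (auto simp: indicator_def)
  have "expectation (\<lambda>\<omega>. threshold_noise q b (V \<omega>)) = expectation (\<lambda>\<omega>. (if b then - 1 else 1) * (?I \<omega> - q))"
    using q by (intro Bochner_Integration.integral_cong) (auto simp: threshold_noise_def indicator_def)
  also have "\<dots> = (if b then - 1 else 1) * (expectation ?I - q)"
    using I by (simp add: prob_space)
  also have "expectation ?I = q" using P by simp
  finally show ?thesis by simp
qed

lemma indep_var_of_indep_algebras:
  assumes indep: "indep_set (sets F) (sets G)" and sp: "space F = space M" "space G = space M"
    and V: "V \<in> borel_measurable F" and W: "W \<in> borel_measurable G"
  shows "indep_var borel V borel (W :: 'a \<Rightarrow> real)"
  unfolding indep_var_eq
proof (intro conjI)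
  have sub: "sets F \<subseteq> events" "sets G \<subseteq> events" using indep by (auto simp: indep_sets2_eq)
  show "random_variable borel V" "random_variable borel W"
    using V W sub sp by (auto simp: measurable_def)
  have "sigma_sets (space M) {V -` A \<inter> space M |A. A \<in> sets borel} \<subseteq> sets F"
    using V unfolding sp(1)[symmetric] by (intro sets.sigma_sets_subset) (auto simp: measurable_def)
  moreover have "sigma_sets (space M) {W -` A \<inter> space M |A. A \<in> sets borel} \<subseteq> sets G"
    using W unfolding sp(2)[symmetric] by (intro sets.sigma_sets_subset) (auto simp: measurable_def)
  ultimately show "indep_set (sigma_sets (space M) {V -` A \<inter> space M |A. A \<in> sets borel})
      (sigma_sets (space M) {W -` A \<inter> space M |A. A \<in> sets borel})"
    using indep unfolding indep_sets2_eq by blast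
qed

text \<open>
  Orthogonality for \<open>i < j\<close>: once the string of the first \<open>j\<close> symbols is fixed to \<open>l\<close>, the two factors
  become functions \<open>A l\<close> of \<open>U i\<close> and \<open>B l\<close> of \<open>U j\<close> alone.  There are finitely many strings, and for
  each of them independence splits off the factor \<open>E (B l (U j)) = 0\<close>.
\<close>

lemma randomization_averages_out:
  assumes Y: "binary_process M Y" and U: "iid_uniform M U" and UY: "indep_processes M U Y"
    and q: "\<And>i l. 0 \<le> q i l \<and> q i l \<le> 1"
  shows "AE \<omega> in M. (\<lambda>n. (\<Sum>i = 1..n.
    threshold_noise (q i (past (\<lambda>j. Y j \<omega>) i)) (Y (int i) \<omega>) (U i \<omega>)) / n) \<longlonglongrightarrow> 0"
proof -
  \<comment> \<open>The sums start at 1, and \<open>U 0\<close> need not be measurable.\<close>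
  define X where "X i \<omega> =
    (if i = 0 then 0 else threshold_noise (q i (past (\<lambda>j. Y j \<omega>) i)) (Y (int i) \<omega>) (U i \<omega>))" for i \<omega>
  have Ym[measurable]: "Y n \<in> M \<rightarrow>\<^sub>M count_space UNIV" for n using Y by (simp add: binary_process_def)
  have Uvars: "indep_vars (\<lambda>_. borel) U {1..}" using U by (simp add: iid_uniform_def)
  have Um: "random_variable borel (U i)" if "i \<ge> 1" for i
    using Uvars that unfolding indep_vars_def by simp
  have Xbnd: "\<bar>X i \<omega>\<bar> \<le> 1" for i \<omega>
    using threshold_noise_bound q by (simp add: X_def)
  define F where "F = vimage_algebra (space M) (\<lambda>\<omega>. \<lambda>i\<in>{1..}. U i \<omega>) (Pi\<^sub>M {1..} (\<lambda>_. borel))"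
  define G where "G = vimage_algebra (space M) (\<lambda>\<omega> n. Y n \<omega>) path_space"
  have FG: "indep_set (sets F) (sets G)" using UY by (simp add: indep_processes_def F_def G_def)
  have spaces: "space F = space M" "space G = space M" by (auto simp: F_def G_def)
  have UF: "U i \<in> borel_measurable F" if "i \<ge> 1" for i
  proof -
    have "(\<lambda>\<omega>. \<lambda>i\<in>{1..}. U i \<omega>) \<in> F \<rightarrow>\<^sub>M Pi\<^sub>M {1..} (\<lambda>_. borel)"
      unfolding F_def by (rule measurable_vimage_algebra1) (auto simp: space_PiM)
    from measurable_compose[OF this measurable_component_singleton[of i]] that show ?thesis by simp
  qed
  have YG: "Y n \<in> G \<rightarrow>\<^sub>M count_space UNIV" for n
  proof -
    have "(\<lambda>\<omega> n. Y n \<omega>) \<in> G \<rightarrow>\<^sub>M path_space"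
      unfolding G_def by (rule measurable_vimage_algebra1) (auto simp: space_PiM)
    from measurable_compose[OF this measurable_component_singleton[of n]] show ?thesis by simp
  qed
  define hist where "hist j \<omega> = map (\<lambda>n. Y n \<omega>) [1..int j]" for j \<omega>
  have hist_G: "hist j \<in> G \<rightarrow>\<^sub>M count_space UNIV" for j
    unfolding hist_def[abs_def] by (rule measurable_map_list) (rule YG)
  have hist_M: "hist j \<in> M \<rightarrow>\<^sub>M count_space UNIV" for j
    unfolding hist_def[abs_def] by (rule measurable_map_list) (rule Ym)
  have length_hist: "length (hist j \<omega>) = j" for j \<omega> by (simp add: hist_def)
  have expand: "X i \<omega> = (\<Sum>l | length l = j.
      of_bool (hist j \<omega> = l) * threshold_noise (q i (take (i - 1) l)) (l ! (i - 1)) (U i \<omega>))"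
    if "1 \<le> i" "i \<le> j" for i j \<omega>
  proof -
    have "past (\<lambda>j. Y j \<omega>) i = take (i - 1) (hist j \<omega>)"
      using that by (intro nth_equalityI) (auto simp: hist_def nth_upto)
    moreover have "Y (int i) \<omega> = hist j \<omega> ! (i - 1)"
      using that nth_upto[of 1 "i - 1" "int j"] by (simp add: hist_def of_nat_diff)
    ultimately have "X i \<omega> = threshold_noise (q i (take (i - 1) (hist j \<omega>))) (hist j \<omega> ! (i - 1)) (U i \<omega>)"
      using that by (simp add: X_def)
    also have "\<dots> = (\<Sum>l | length l = j. if l = hist j \<omega>
        then threshold_noise (q i (take (i - 1) l)) (l ! (i - 1)) (U i \<omega>) else 0)"
      using finite_contexts[of j] by (simp add: length_hist)
    also have "\<dots> = (\<Sum>l | length l = j.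
        of_bool (hist j \<omega> = l) * threshold_noise (q i (take (i - 1) l)) (l ! (i - 1)) (U i \<omega>))"
      by (intro sum.cong) auto
    finally show ?thesis .
  qed
  have "AE \<omega> in M. (\<lambda>n. (\<Sum>i = 1..n. X i \<omega>) / n) \<longlonglongrightarrow> 0"
  proof (rule slln_orthogonal)
    fix i
    show "random_variable borel (X i)"
    proof (cases "i = 0")
      case True
      then show ?thesis by (simp add: X_def[abs_def])
    next
      case False
      have X_eq: "X i = (\<lambda>\<omega>. \<Sum>l | length l = i.
          of_bool (hist i \<omega> = l) * threshold_noise (q i (take (i - 1) l)) (l ! (i - 1)) (U i \<omega>))"
        using False by (intro ext expand) auto
      have "(\<lambda>\<omega>. of_bool (hist i \<omega> = l) :: real) \<in> borel_measurable M" for l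
        by (rule measurable_compose[OF hist_M, of "\<lambda>h. of_bool (h = l)"]) simp
      moreover have "(\<lambda>\<omega>. threshold_noise r b (U i \<omega>)) \<in> borel_measurable M" for r b
        using False by (intro measurable_compose[OF Um threshold_noise_measurable]) simp
      ultimately show ?thesis
        using False by (subst X_eq) (intro borel_measurable_sum borel_measurable_times)
    qed
    show "\<bar>X i \<omega>\<bar> \<le> 1" for \<omega> by (rule Xbnd)
    fix j assume ij: "1 \<le> i" "i < j"
    define A where "A l u = threshold_noise (q i (take (i - 1) l)) (l ! (i - 1)) u" for l u
    define B where "B l u = threshold_noise (q j (take (j - 1) l)) (l ! (j - 1)) u" for l u
    have AB: "\<bar>A l u\<bar> \<le> 1" "\<bar>B l u\<bar> \<le> 1" "A l \<in> borel_measurable borel" "B l \<in> borel_measurable borel" for l u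
      using q by (auto simp: A_def[abs_def] B_def[abs_def] threshold_noise_bound)
    have prod_expand: "X i \<omega> * X j \<omega>
        = (\<Sum>l | length l = j. of_bool (hist j \<omega> = l) * (A l (U i \<omega>) * B l (U j \<omega>)))" for \<omega>
    proof -
      have "X i \<omega> * X j \<omega> = (\<Sum>l | length l = j. of_bool (hist j \<omega> = l) * A l (U i \<omega>)) * X j \<omega>"
        using ij by (subst expand[of i j]) (auto simp: A_def)
      also have "\<dots> = (\<Sum>l | length l = j. of_bool (hist j \<omega> = l) * (A l (U i \<omega>) * B l (U j \<omega>)))"
        unfolding sum_distrib_right
      proof (intro sum.cong refl)
        fix l assume "l \<in> {l :: bool list. length l = j}"
        have "X j \<omega> = B (hist j \<omega>) (U j \<omega>)"
          using ij finite_contexts[of j] length_hist[of j \<omega>]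
          by (subst expand[of j j]) (auto simp: B_def of_bool_def sum.delta if_distrib[of "\<lambda>x. x * _"] cong: if_cong)
        then show "of_bool (hist j \<omega> = l) * A l (U i \<omega>) * X j \<omega>
            = of_bool (hist j \<omega> = l) * (A l (U i \<omega>) * B l (U j \<omega>))" by simp
      qed
      finally show ?thesis .
    qed
    have term_zero: "expectation (\<lambda>\<omega>. of_bool (hist j \<omega> = l) * (A l (U i \<omega>) * B l (U j \<omega>))) = 0"
      and term_int: "integrable M (\<lambda>\<omega>. of_bool (hist j \<omega> = l) * (A l (U i \<omega>) * B l (U j \<omega>)))" for l
    proof -
      have W: "(\<lambda>\<omega>. of_bool (hist j \<omega> = l) :: real) \<in> borel_measurable G"
        by (rule measurable_compose[OF hist_G, of "\<lambda>h. of_bool (h = l)"]) simp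
      have V: "(\<lambda>\<omega>. A l (U i \<omega>) * B l (U j \<omega>)) \<in> borel_measurable F"
        using ij by (intro borel_measurable_times measurable_compose[OF UF AB(3)] measurable_compose[OF UF AB(4)]) auto
      have ind: "indep_var borel (\<lambda>\<omega>. of_bool (hist j \<omega> = l)) borel (\<lambda>\<omega>. A l (U i \<omega>) * B l (U j \<omega>))"
      proof -
        have GF: "indep_set (sets G) (sets F)" using FG unfolding indep_sets2_eq
          by (metis Int_commute mult.commute)
        show ?thesis by (rule indep_var_of_indep_algebras[OF GF spaces(2,1) W V])
      qed
      note rv = ind[THEN indep_var_rv1] ind[THEN indep_var_rv2]
      have i1: "integrable M (\<lambda>\<omega>. of_bool (hist j \<omega> = l) :: real)"
        using rv by (intro integrable_const_bound[where B=1]) auto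
      have i2: "integrable M (\<lambda>\<omega>. A l (U i \<omega>) * B l (U j \<omega>))"
        using rv AB by (intro integrable_const_bound[where B=1]) (auto simp: abs_mult intro!: mult_le_one)
      show "integrable M (\<lambda>\<omega>. of_bool (hist j \<omega> = l) * (A l (U i \<omega>) * B l (U j \<omega>)))"
        by (rule indep_var_integrable[OF ind i1 i2])
      have "expectation (\<lambda>\<omega>. A l (U i \<omega>) * B l (U j \<omega>)) = expectation (\<lambda>\<omega>. A l (U i \<omega>)) * expectation (\<lambda>\<omega>. B l (U j \<omega>))"
      proof -
        have "indep_vars (\<lambda>_. borel) U {i, j}" using ij by (intro indep_vars_subset[OF Uvars]) auto
        then have "indep_vars (\<lambda>_. borel) (\<lambda>k \<omega>. (if k = i then A l else B l) (U k \<omega>)) {i, j}"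
          by (rule indep_vars_compose2) (auto simp: AB)
        moreover have "integrable M (\<lambda>\<omega>. (if k = i then A l else B l) (U k \<omega>))" if "k \<in> {i, j}" for k
        proof (rule integrable_const_bound[where B=1])
          show "(\<lambda>\<omega>. (if k = i then A l else B l) (U k \<omega>)) \<in> borel_measurable M"
            using that ij AB by (intro measurable_compose[OF Um]) auto
        qed (use AB in auto)
        ultimately
        have "expectation (\<lambda>\<omega>. \<Prod>k\<in>{i, j}. (if k = i then A l else B l) (U k \<omega>))
            = (\<Prod>k\<in>{i, j}. expectation (\<lambda>\<omega>. (if k = i then A l else B l) (U k \<omega>)))"
          by (intro indep_vars_lebesgue_integral) auto
        then show ?thesis using ij by simp
      qed
      moreover have "expectation (\<lambda>\<omega>. B l (U j \<omega>)) = 0"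
        unfolding B_def using U ij Um[of j] q by (intro threshold_noise_centered) (auto simp: iid_uniform_def)
      ultimately have "expectation (\<lambda>\<omega>. A l (U i \<omega>) * B l (U j \<omega>)) = 0" by simp
      then show "expectation (\<lambda>\<omega>. of_bool (hist j \<omega> = l) * (A l (U i \<omega>) * B l (U j \<omega>))) = 0"
        using indep_var_lebesgue_integral[OF ind i1 i2] by simp
    qed
    show "expectation (\<lambda>\<omega>. X i \<omega> * X j \<omega>) = 0"
      unfolding prod_expand by (subst Bochner_Integration.integral_sum) (auto simp: term_zero term_int)
  qed
  moreover have "(\<Sum>i = 1..n. X i \<omega>) = (\<Sum>i = 1..n.
    threshold_noise (q i (past (\<lambda>j. Y j \<omega>) i)) (Y (int i) \<omega>) (U i \<omega>))" for n \<omega>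
    by (intro sum.cong) (auto simp: X_def)
  ultimately show ?thesis by simp
qed

section \<open>From processes to path measures\<close>

lemma path_measurable:
  assumes "binary_process M Y"
  shows "(\<lambda>\<omega> n. Y n \<omega>) \<in> M \<rightarrow>\<^sub>M path_space"
  using assms unfolding binary_process_def
  by (intro measurable_PiM_single') (auto simp: space_PiM)

lemma ergodic_path_distr:
  assumes Y: "binary_process M Y" and st: "stationary M Y" and er: "ergodic M Y"
  shows "ergodic_path (distr M path_space (\<lambda>\<omega> n. Y n \<omega>))"
proof -
  note path[measurable] = path_measurable[OF Y]
  let ?\<mu> = "distr M path_space (\<lambda>\<omega> n. Y n \<omega>)"
  have shift_by: "shift_by 1 \<in> path_space \<rightarrow>\<^sub>M path_space"
    unfolding shift_by_def[abs_def] by (rule measurable_PiM_single') (auto simp: space_PiM)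
  interpret path: prob_space ?\<mu> by (rule prob_space_distr) (rule path)
  show ?thesis
  proof
    show "sets ?\<mu> = sets path_space" by simp
    have "distr ?\<mu> path_space (shift_by 1) = distr M path_space (\<lambda>\<omega> n. Y (n + 1) \<omega>)"
      by (subst distr_distr[OF shift_by path]) (simp add: comp_def shift_by_def)
    also have "\<dots> = ?\<mu>" using st by (simp add: stationary_def)
    finally show "distr ?\<mu> ?\<mu> (shift_by 1) = ?\<mu>" by (simp cong: distr_cong)
  next
    fix A assume A: "A \<in> sets path_space" "shift_by 1 -` A = A"
    have "measure ?\<mu> A = prob {\<omega> \<in> space M. (\<lambda>n. Y n \<omega>) \<in> A}"
      using A(1) by (subst measure_distr) (auto simp: vimage_def Int_def conj_commute)
    then show "measure ?\<mu> A \<in> {0, 1}"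
      using er A unfolding ergodic_def shift_by_def[abs_def] by auto
  qed
qed

text \<open>
  The version of the conditional probability constructed on path space, composed with the process,
  has the defining property of the conditional probability on the original space.
\<close>

lemma optimal_loss_eq_bayes_loss:
  assumes Y: "binary_process M Y" and erg: "ergodic_path (distr M path_space (\<lambda>\<omega> n. Y n \<omega>))"
  shows "optimal_loss M Y = ergodic_path.bayes_loss (distr M path_space (\<lambda>\<omega> n. Y n \<omega>))"
proof -
  let ?y = "\<lambda>\<omega> n. Y n \<omega>"
  define \<mu> where "\<mu> = distr M path_space ?y"
  note path[measurable] = path_measurable[OF Y]
  have [measurable]: "?y \<in> M \<rightarrow>\<^sub>M \<mu>" unfolding \<mu>_def by simp
  have integral_path: "(\<integral>y. f y \<partial>\<mu>) = (\<integral>\<omega>. f (?y \<omega>) \<partial>M)"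
    if "f \<in> borel_measurable \<mu>" for f :: "_ \<Rightarrow> real"
    using that unfolding \<mu>_def by (intro integral_distr[OF path]) simp
  interpret E: ergodic_path \<mu> using erg by (simp add: \<mu>_def)
  have past_eq: "past_algebra M Y = vimage_algebra (space M) ?y path_past"
    unfolding path_past_def past_algebra_def
    by (subst vimage_algebra_vimage_algebra_eq) (auto simp: space_PiM)
  have y_past: "?y \<in> M \<rightarrow>\<^sub>M path_past"
    using measurable_compose[OF path, of "\<lambda>y. y"] E.path_past_subalgebra
    by (intro measurable_path_pastI) (use Y in \<open>simp add: binary_process_def\<close>)
  interpret P: finite_measure_subalgebra M "past_algebra M Y"
    by unfold_locales (auto simp: subalgebra_def past_eq intro!: subsetD[OF sets_image_in_sets[OF refl y_past]])
  have cond: "AE \<omega> in M. cond_prob_past M Y b \<omega> = (if b then E.true_prob (?y \<omega>) else 1 - E.true_prob (?y \<omega>))" for b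
    unfolding cond_prob_past_def
  proof (rule P.real_cond_exp_charact)
    let ?true_prob = "\<lambda>y. if b then E.true_prob y else 1 - E.true_prob y"
    have cm: "?true_prob \<in> borel_measurable path_past" by (cases b) auto
    have cM[measurable]: "?true_prob \<in> borel_measurable \<mu>" by (rule E.past_measurable_imp[OF cm])
    have true_prob_bnd: "\<bar>?true_prob y\<bar> \<le> 1" for y using E.true_prob_range[of y] by auto
    have Y0: "{\<omega> \<in> space M. Y 0 \<omega> = b} \<in> events"
      using Y unfolding binary_process_def by measurable
    show "integrable M (indicat_real {\<omega> \<in> space M. Y 0 \<omega> = b})"
      using Y0 by (intro integrable_const_bound[where B=1]) (auto simp: indicator_def)
    show "integrable M (\<lambda>\<omega>. if b then E.true_prob (?y \<omega>) else 1 - E.true_prob (?y \<omega>))"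
      by (rule integrable_const_bound[where B=1])
         (use true_prob_bnd measurable_compose[OF \<open>?y \<in> M \<rightarrow>\<^sub>M \<mu>\<close> cM] in auto)
    show "(\<lambda>\<omega>. if b then E.true_prob (?y \<omega>) else 1 - E.true_prob (?y \<omega>)) \<in> borel_measurable (past_algebra M Y)"
      unfolding past_eq by (rule measurable_compose[OF measurable_vimage_algebra1 cm]) auto
    fix A assume "A \<in> sets (past_algebra M Y)"
    then obtain B where B: "B \<in> sets path_past" "A = ?y -` B \<inter> space M"
      unfolding past_eq by (subst (asm) sets_vimage_algebra2) auto
    have Bm: "indicat_real B \<in> borel_measurable path_past" using B(1) by simp
    have BM[measurable]: "indicat_real B \<in> borel_measurable \<mu>" by (rule E.past_measurable_imp[OF Bm])
    have split: "(\<integral>y. indicat_real B y * of_bool (y 0 = b) \<partial>\<mu>) = (\<integral>y. indicat_real B y * ?true_prob y \<partial>\<mu>)"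
    proof (cases b)
      case True
      then show ?thesis using E.integral_true_prob[OF Bm, of 1] by (simp add: indicator_def)
    next
      case False
      have i: "integrable \<mu> (\<lambda>y. indicat_real B y)" "integrable \<mu> (\<lambda>y. indicat_real B y * of_bool (y 0))"
          "integrable \<mu> (\<lambda>y. indicat_real B y * E.true_prob y)"
      proof -
        have "(\<lambda>y. indicat_real B y * of_bool (y 0)) \<in> borel_measurable \<mu>"
            "(\<lambda>y. indicat_real B y * E.true_prob y) \<in> borel_measurable \<mu>"
          by (intro borel_measurable_times BM E.true_prob_measurable measurable_compose[OF E.coord_measurable]; simp)+
        note m = BM this
        show "integrable \<mu> (\<lambda>y. indicat_real B y)"
          by (rule E.integrable_bounded[where C=1, OF m(1)]) (simp add: indicator_def)
        show "integrable \<mu> (\<lambda>y. indicat_real B y * of_bool (y 0))"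
          by (rule E.integrable_bounded[where C=1, OF m(2)]) (simp add: indicator_def)
        show "integrable \<mu> (\<lambda>y. indicat_real B y * E.true_prob y)"
          by (rule E.integrable_bounded[where C=1, OF m(3)]) (use E.true_prob_range in \<open>simp add: indicator_def\<close>)
      qed
      have "(\<integral>y. indicat_real B y * of_bool (y 0 = b) \<partial>\<mu>)
          = (\<integral>y. indicat_real B y - indicat_real B y * of_bool (y 0) \<partial>\<mu>)"
        using False by (intro Bochner_Integration.integral_cong) auto
      also have "\<dots> = (\<integral>y. indicat_real B y \<partial>\<mu>) - (\<integral>y. indicat_real B y * E.true_prob y \<partial>\<mu>)"
        using i E.integral_true_prob[OF Bm, of 1] by (simp add: indicator_def)
      also have "\<dots> = (\<integral>y. indicat_real B y - indicat_real B y * E.true_prob y \<partial>\<mu>)" using i by simp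
      finally show ?thesis using False by (simp add: right_diff_distrib)
    qed
    have "(LINT \<omega>:A|M. indicat_real {\<omega> \<in> space M. Y 0 \<omega> = b} \<omega>)
        = (\<integral>\<omega>. indicat_real B (?y \<omega>) * of_bool (?y \<omega> 0 = b) \<partial>M)"
      unfolding set_lebesgue_integral_def
      by (intro Bochner_Integration.integral_cong) (auto simp: B indicator_def)
    also have "\<dots> = (\<integral>y. indicat_real B y * of_bool (y 0 = b) \<partial>\<mu>)"
      by (intro integral_path[symmetric] borel_measurable_times BM measurable_compose[OF E.coord_measurable]) simp
    also note split
    also have "(\<integral>y. indicat_real B y * ?true_prob y \<partial>\<mu>) = (\<integral>\<omega>. indicat_real B (?y \<omega>) * ?true_prob (?y \<omega>) \<partial>M)"
      by (intro integral_path borel_measurable_times BM cM)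
    also have "\<dots> = (LINT \<omega>:A|M. if b then E.true_prob (?y \<omega>) else 1 - E.true_prob (?y \<omega>))"
      unfolding set_lebesgue_integral_def
      by (intro Bochner_Integration.integral_cong) (auto simp: B indicator_def)
    finally show "(LINT \<omega>:A|M. indicat_real {\<omega> \<in> space M. Y 0 \<omega> = b} \<omega>)
        = (LINT \<omega>:A|M. if b then E.true_prob (?y \<omega>) else 1 - E.true_prob (?y \<omega>))" .
  qed
  have "AE \<omega> in M. min (cond_prob_past M Y True \<omega>) (cond_prob_past M Y False \<omega>)
      = min (E.true_prob (?y \<omega>)) (1 - E.true_prob (?y \<omega>))"
    using cond[of True] cond[of False] by eventually_elim simp
  then have "optimal_loss M Y = (\<integral>\<omega>. min (E.true_prob (?y \<omega>)) (1 - E.true_prob (?y \<omega>)) \<partial>M)"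
    unfolding optimal_loss_def by (intro integral_cong_AE) (auto simp: cond_prob_past_def)
  also have "\<dots> = E.bayes_loss"
    unfolding E.bayes_loss_def by (rule integral_path[symmetric]) measurable
  finally show ?thesis by (simp add: \<mu>_def)
qed

end

theorem theorem3:
  fixes M :: "'a measure" and Y :: "int \<Rightarrow> 'a \<Rightarrow> bool" and U :: "nat \<Rightarrow> 'a \<Rightarrow> real"
  assumes "prob_space M"
    and "binary_process M Y" and "stationary M Y" and "ergodic M Y"
    and "iid_uniform M U" and "indep_processes M U Y"
  shows "AE \<omega> in M. (\<lambda>n. strategy_loss scheme n (\<lambda>j. Y j \<omega>) (\<lambda>i. U i \<omega>))
           \<longlonglongrightarrow> optimal_loss M Y"
proof -
  interpret prob_space M by fact
  let ?\<mu> = "distr M path_space (\<lambda>\<omega> n. Y n \<omega>)"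
  have erg: "ergodic_path ?\<mu>" using assms(2-4) by (rule ergodic_path_distr)
  have "AE y in ?\<mu>. (\<lambda>n. (\<Sum>i = 1..n. mean_err y i) / n) \<longlonglongrightarrow> optimal_loss M Y"
    using ergodic_path.mean_err_converges[OF erg] optimal_loss_eq_bayes_loss[OF assms(2) erg] by simp
  then have mean: "AE \<omega> in M. (\<lambda>n. (\<Sum>i = 1..n. mean_err (\<lambda>j. Y j \<omega>) i) / n) \<longlonglongrightarrow> optimal_loss M Y"
    by (rule AE_distrD[OF path_measurable[OF assms(2)]])
  have "AE \<omega> in M. (\<lambda>n. (\<Sum>i = 1..n.
      threshold_noise (mean_pred i (past (\<lambda>j. Y j \<omega>) i)) (Y (int i) \<omega>) (U i \<omega>)) / n) \<longlonglongrightarrow> 0"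
    by (rule randomization_averages_out[OF assms(2,5,6)]) (simp add: mean_pred_range)
  with mean show ?thesis
  proof eventually_elim
    case (elim \<omega>)
    have "strategy_loss scheme n (\<lambda>j. Y j \<omega>) (\<lambda>i. U i \<omega>) = (\<Sum>i = 1..n. mean_err (\<lambda>j. Y j \<omega>) i) / n
      + (\<Sum>i = 1..n. threshold_noise (mean_pred i (past (\<lambda>j. Y j \<omega>) i)) (Y (int i) \<omega>) (U i \<omega>)) / n" for n
      unfolding strategy_loss_def add_divide_distrib[symmetric] sum.distrib[symmetric]
      by (intro arg_cong[where f="\<lambda>x. x / real n"] sum.cong)
         (auto simp: mean_err_def threshold_noise_def scheme_eq)
    then show ?case using tendsto_add[OF elim] by simp
  qed
qed

end
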